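(* Let $-1<q<1$. If $\max(|a|,|b|,|c|,|d|)<1$ ($a,b,c,d$ real or complex), then for every integer $n\ge 0$ $$\int_{-1}^{1}h_n(x|q)\,f_{AW}(x|a,b,c,d,q)\,dx=\sigma_n^{(4)}(a,b,c,d|q).$$
   Context: Notation (with $-1<q<1$, $0^0=1$): $(a)_n=(a;q)_n=\prod_{j=0}^{n-1}(1-aq^j)$, $(a)_0=1$, $(a)_\infty=\prod_{j\ge 0}(1-aq^j)$, $(a_1,\ldots,a_k)_\infty=\prod_{j=1}^k (a_j)_\infty$; $(q)_n=(q;q)_n=\prod_{j=1}^n(1-q^j)$; $\binom{n}{k}_q=\frac{(q)_n}{(q)_{n-k}(q)_k}$ for $0\le k\le n$ and $0$ otherwise. The continuous $q$-Hermite polynomials $h_n(x|q)$ are given by $h_{-1}=0$, $h_0=1$, $h_{n+1}(x|q)=2x\,h_n(x|q)-(1-q^n)h_{n-1}(x|q)$. Their orthogonalizing density on $[-1,1]$ is $$f_h(x|q)=\frac{2(q)_\infty\sqrt{1-x^2}}{\pi}\prod_{k=1}^\infty l(x|q^k),\qquad l(x|a)=(1+a)^2-4ax^2,$$ and their generating function is, for $|t|<1$, $$\varphi_h(x|t,q)=\sum_{j\ge0}\frac{t^j}{(q)_j}h_j(x|q)=\frac{1}{\prod_{k=0}^\infty v(x|tq^k)},\qquad v(x|t)=1-2tx+t^2.$$ $S_n^{(2)}(a,b|q)=\sum_{k=0}^n\binom{n}{k}_q a^k b^{n-k}$. The Askey--Wilson density is $$f_{AW}(x|a,b,c,d,q)=\frac{(ab,ac,ad,bc,bd,cd)_\infty}{(abcd)_\infty}\,f_h(x|q)\,\varphi_h(x|a,q)\varphi_h(x|b,q)\varphi_h(x|c,q)\varphi_h(x|d,q),$$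 and $$\sigma_n^{(4)}(a,b,c,d|q)=\sum_{j=0}^{n}\binom{n}{j}_q\frac{(bd)_j}{(abcd)_j}\,S_{n-j}^{(2)}(b,d|q)\sum_{k=0}^{j}\binom{j}{k}_q (cb)_k\,a^k\,(ad)_{j-k}\,c^{j-k}.$$ *)

theory Defs
  imports "HOL-Analysis.Analysis"
begin

text \<open>
  The base \<open>q\<close> is always real, with \<open>\<bar>q\<bar> < 1\<close> wherever the definitions are used;
  the parameters \<open>a, b, c, d, t\<close> are complex. The convention \<open>0 ^ 0 = 1\<close> is built into
  \<open>power\<close>, so the case \<open>q = 0\<close> needs no special treatment.
\<close>

definition qpoch :: "'a::real_normed_field \<Rightarrow> real \<Rightarrow> nat \<Rightarrow> 'a" where
  "qpoch a q n = (\<Prod>j<n. 1 - a * of_real q ^ j)"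

definition qpoch_inf :: "'a::real_normed_field \<Rightarrow> real \<Rightarrow> 'a" where
  "qpoch_inf a q = (\<Prod>j. 1 - a * of_real q ^ j)"

definition qbinomial :: "nat \<Rightarrow> nat \<Rightarrow> real \<Rightarrow> real" where
  "qbinomial n k q =
     (if k \<le> n then qpoch q q n / (qpoch q q (n - k) * qpoch q q k) else 0)"

text \<open>
  Three-term recurrence \<open>h\<^sub>n\<^sub>+\<^sub>1 = 2 x h\<^sub>n - (1 - q\<^sup>n) h\<^sub>n\<^sub>-\<^sub>1\<close>;
  the second equation is its instance \<open>n = 0\<close>, with \<open>h\<^sub>-\<^sub>1 = 0\<close>.
\<close>

fun qhermite :: "nat \<Rightarrow> real \<Rightarrow> real \<Rightarrow> real" where
  "qhermite 0 x q = 1"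
| "qhermite (Suc 0) x q = 2 * x"
| "qhermite (Suc (Suc n)) x q =
     2 * x * qhermite (Suc n) x q - (1 - q ^ Suc n) * qhermite n x q"

definition qhermite_l :: "real \<Rightarrow> real \<Rightarrow> real" where
  "qhermite_l x a = (1 + a)\<^sup>2 - 4 * a * x\<^sup>2"

text \<open>The product starts at \<open>q\<^sup>1\<close>, hence the shift to \<open>Suc k\<close>.\<close>

definition qhermite_density :: "real \<Rightarrow> real \<Rightarrow> real" where
  "qhermite_density x q =
     2 * qpoch_inf q q * sqrt (1 - x\<^sup>2) / pi * (\<Prod>k. qhermite_l x (q ^ Suc k))"

definition qhermite_gf :: "real \<Rightarrow> complex \<Rightarrow> real \<Rightarrow> complex" where
  "qhermite_gf x t q = (\<Sum>j. t ^ j / of_real (qpoch q q j) * of_real (qhermite j x q))"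

definition AW_density ::
  "real \<Rightarrow> complex \<Rightarrow> complex \<Rightarrow> complex \<Rightarrow> complex \<Rightarrow> real \<Rightarrow> complex" where
  "AW_density x a b c d q =
     (qpoch_inf (a * b) q * qpoch_inf (a * c) q * qpoch_inf (a * d) q *
      qpoch_inf (b * c) q * qpoch_inf (b * d) q * qpoch_inf (c * d) q) /
     qpoch_inf (a * b * c * d) q *
     of_real (qhermite_density x q) *
     qhermite_gf x a q * qhermite_gf x b q * qhermite_gf x c q * qhermite_gf x d q"

definition S2 :: "nat \<Rightarrow> complex \<Rightarrow> complex \<Rightarrow> real \<Rightarrow> complex" where
  "S2 n a b q = (\<Sum>k\<le>n. of_real (qbinomial n k q) * a ^ k * b ^ (n - k))"

definition sigma4 ::
  "nat \<Rightarrow> complex \<Rightarrow> complex \<Rightarrow> complex \<Rightarrow> complex \<Rightarrow> real \<Rightarrow> complex" where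
  "sigma4 n a b c d q =
     (\<Sum>j\<le>n. of_real (qbinomial n j q) * (qpoch (b * d) q j / qpoch (a * b * c * d) q j) *
        S2 (n - j) b d q *
        (\<Sum>k\<le>j. of_real (qbinomial j k q) * qpoch (c * b) q k * a ^ k *
           qpoch (a * d) q (j - k) * c ^ (j - k)))"

end

theory Submission
  imports Defs "HOL-Complex_Analysis.Complex_Analysis"
begin

text \<open>
  Let \<open>I n a b c d\<close> be the integral of \<open>h\<^sub>n\<close> against the density \<open>f\<^sub>h\<close> and the four generating
  functions \<open>\<phi>\<^sub>h(\<cdot>|a), \<dots>, \<phi>\<^sub>h(\<cdot>|d)\<close>, and let \<open>m(a,b,c,d)\<close> be the quotient of infinite products
  with which \<open>f\<^sub>A\<^sub>W\<close> is normalised. The claim is \<open>I n = m \<sigma>\<^sub>n\<^sup>(\<^sup>4\<^sup>)\<close>. Both sides are holomorphic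
  in \<open>a\<close> on the unit disc, and both satisfy the dilation equation
  \<open>D\<^sub>n(q a) = (1 + a\<^sup>2) D\<^sub>n(a) - a D\<^sub>n\<^sub>+\<^sub>1(a) - a (1 - q\<^sup>n) D\<^sub>n\<^sub>-\<^sub>1(a)\<close>.

  For the integral this is the functional equation \<open>\<phi>\<^sub>h(x|q a) = (1 - 2 a x + a\<^sup>2) \<phi>\<^sub>h(x|a)\<close>
  combined with \<open>2 x h\<^sub>n = h\<^sub>n\<^sub>+\<^sub>1 + (1 - q\<^sup>n) h\<^sub>n\<^sub>-\<^sub>1\<close>. For the right-hand side it is a polynomial
  identity (\<open>sigma4_dilate\<close>). Its source is the expansion of \<open>h\<^sub>n\<close> in the Al-Salam--Chihara
  polynomials with parameters \<open>b, d\<close>, whose coefficients are \<open>q\<close>-binomial multiples of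
  \<open>S\<^sup>(\<^sup>2\<^sup>)(b,d)\<close>: the remaining factors in \<open>\<sigma>\<^sub>n\<^sup>(\<^sup>4\<^sup>)\<close> play the part of the integrals of the
  Al-Salam--Chihara polynomials, and it suffices that they obey the dilation equation which
  belongs to the three-term recurrence of these polynomials (\<open>AW_coeff_dilate\<close>).

  Since \<open>q\<^sup>i \<noteq> 1\<close> for \<open>i > 0\<close>, the dilation equation determines all Taylor coefficients at
  \<open>a = 0\<close> from the values at \<open>a = 0\<close> (\<open>hermite_dilation_unique\<close>). Hence the claim for
  \<open>(0,b,c,d)\<close> implies the claim for \<open>(a,b,c,d)\<close>. The integral is symmetric in its parameters, and
  the symmetry of the right-hand side is visible when some parameters vanish, so four applications
  remove all parameters. What is left is that \<open>f\<^sub>h\<close> has total mass 1 and annihilates every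
  \<open>h\<^sub>n\<close> with \<open>n > 0\<close>. For this the infinite product in \<open>f\<^sub>h\<close> is cut off after \<open>N\<close> factors: the
  truncated moments have a closed form (\<open>trunc_moment_even\<close>), proved by induction on \<open>N\<close> from
  Rogers' formula \<open>h\<^sub>n(cos t) = S\<^sub>n\<^sup>(\<^sup>2\<^sup>)(e\<^sup>i\<^sup>t, e\<^sup>-\<^sup>i\<^sup>t)\<close> for \<open>N = 0\<close>, and the limit can be read off.
\<close>

section \<open>\<open>q\<close>-shifted factorials and the polynomials on the right-hand side\<close>

lemma qpoch_0 [simp]: "qpoch a q 0 = 1"
  by (simp add: qpoch_def)

lemma qpoch_Suc: "qpoch a q (Suc n) = qpoch a q n * (1 - a * of_real q ^ n)"
  by (simp add: qpoch_def)

lemma qpoch_zero_left [simp]: "qpoch 0 q n = 1"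
  by (simp add: qpoch_def)

lemma qpoch_shift: "(1 - a) * qpoch (of_real q * a) q n = qpoch a q (Suc n)"
  unfolding qpoch_def by (subst prod.lessThan_Suc_shift) (simp add: mult_ac)

lemma of_real_qpoch: "of_real (qpoch a q n) = qpoch (of_real a) q n"
  by (simp add: qpoch_def)

lemma qpoch_nonzero:
  fixes a :: complex
  assumes "\<bar>q\<bar> < 1" "norm a < 1"
  shows "qpoch a q n \<noteq> 0"
proof -
  have "norm (a * of_real q ^ j) < 1" for j
    using assms by (auto simp: norm_mult norm_power intro!: mult_le_one power_le_one
      le_less_trans[OF mult_right_le_one_le])
  hence "1 - a * of_real q ^ j \<noteq> 0" for j
    by (metis eq_iff_diff_eq_0 norm_one order_less_irrefl)
  thus ?thesis
    by (simp add: qpoch_def)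
qed

locale qbase =
  fixes q :: real
  assumes abs_q: "\<bar>q\<bar> < 1"
begin

abbreviation qfac :: "nat \<Rightarrow> complex" where
  "qfac n \<equiv> qpoch (of_real q) q n"

abbreviation qc :: complex where
  "qc \<equiv> of_real q"

lemma qfac_Suc: "qfac (Suc n) = qfac n * (1 - qc ^ Suc n)"
  by (simp add: qpoch_Suc)

lemma qfac_nonzero [simp]: "qfac n \<noteq> 0"
  using abs_q by (intro qpoch_nonzero) auto

lemma power_neq_1: "n > 0 \<Longrightarrow> qc ^ n \<noteq> 1"
  using abs_q power_less_one_iff[of "\<bar>q\<bar>" n]
  by (metis abs_ge_zero norm_of_real norm_one norm_power order_less_irrefl)

lemma qbinomial_eq:
  "k \<le> n \<Longrightarrow> complex_of_real (qbinomial n k q) = qfac n / (qfac (n - k) * qfac k)"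
  by (simp add: qbinomial_def of_real_qpoch)

text \<open>
  The inner sum of \<^const>\<open>sigma4\<close>, which interpolates between a monomial in \<open>a\<close> (for \<open>c = 0\<close>), a
  monomial in \<open>c\<close> (for \<open>a = 0\<close>) and \<^const>\<open>S2\<close> (for \<open>b = d = 0\<close>).
\<close>

definition asc_conv :: "nat \<Rightarrow> complex \<Rightarrow> complex \<Rightarrow> complex \<Rightarrow> complex \<Rightarrow> complex" where
  "asc_conv n a b c d = (\<Sum>k\<le>n. of_real (qbinomial n k q) * qpoch (c * b) q k * a ^ k *
      qpoch (a * d) q (n - k) * c ^ (n - k))"

text \<open>
  By the \<open>q\<close>-binomial theorem this is the expansion of \<open>(a e s)\<^sub>\<infinity> / (a s)\<^sub>\<infinity>\<close> in powers of \<open>s\<close>.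
\<close>

definition qbin_fps :: "complex \<Rightarrow> complex \<Rightarrow> complex fps" where
  "qbin_fps a e = Abs_fps (\<lambda>k. qpoch e q k * a ^ k / qfac k)"

lemma asc_conv_eq_fps_nth: "asc_conv n a b c d = qfac n * fps_nth (qbin_fps a (c * b) * qbin_fps c (a * d)) n"
  unfolding asc_conv_def qbin_fps_def fps_mult_nth sum_distrib_left atLeast0AtMost
  by (rule sum.cong) (auto simp: qbinomial_eq mult_ac)

text \<open>
  The shift \<open>s \<mapsto> q s\<close> removes one factor from each of the two infinite products, a fact that the
  coefficients express without any convergence.
\<close>

lemma qbin_fps_functional_equation:
  "(1 - fps_const a * fps_X) * qbin_fps a e =
   (1 - fps_const (a * e) * fps_X) * fps_compose (qbin_fps a e) (fps_const qc * fps_X)"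
proof (rule fps_ext)
  fix n
  show "fps_nth ((1 - fps_const a * fps_X) * qbin_fps a e) n =
   fps_nth ((1 - fps_const (a * e) * fps_X) * fps_compose (qbin_fps a e) (fps_const qc * fps_X)) n"
  proof (cases n)
    case 0
    then show ?thesis by (simp add: qbin_fps_def)
  next
    case (Suc m)
    have "qfac (Suc m) = qfac m * (1 - qc ^ Suc m)" by (rule qfac_Suc)
    with power_neq_1[of "Suc m"] show ?thesis
      unfolding fps_compose_linear Suc
      by (simp add: qbin_fps_def left_diff_distrib mult.assoc qpoch_Suc[of e] divide_simps)
         (simp add: algebra_simps)
  qed
qed

lemma asc_conv_0 [simp]: "asc_conv 0 a b c d = 1"
  by (simp add: asc_conv_def qbinomial_def)

text \<open>
  The generating function of \<^const>\<open>asc_conv\<close> is a product of two \<open>q\<close>-binomial series; comparing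
  coefficients in the product of their functional equations gives a three-term recurrence. For
  \<open>j = 0\<close> the factor \<open>1 - q\<^sup>0\<close> makes the value at the truncated index \<open>j - 1\<close> immaterial, and the
  same convention is used in all recurrences below.
\<close>

lemma asc_conv_recurrence:
  "asc_conv (Suc j) a b c d = ((a + c) - a * c * (b + d) * qc ^ j) * asc_conv j a b c d
     - a * c * (1 - a * b * c * d * qc ^ (j - 1)) * (1 - qc ^ j) * asc_conv (j - 1) a b c d"
proof -
  define G where "G = qbin_fps a (c * b) * qbin_fps c (a * d)"
  have "(1 - fps_const a * fps_X) * (1 - fps_const c * fps_X) * G =
    (1 - fps_const (a * (c * b)) * fps_X) * (1 - fps_const (c * (a * d)) * fps_X) *
       fps_compose G (fps_const qc * fps_X)"
    using qbin_fps_functional_equation[of a "c * b"] qbin_fps_functional_equation[of c "a * d"]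
    by (simp add: G_def fps_compose_mult_distrib) algebra
  hence eq: "(G - fps_const (a + c) * (fps_X * G) + fps_const (a * c) * (fps_X * (fps_X * G))) =
    (let H = Abs_fps (\<lambda>n. qc ^ n * fps_nth G n) in
     H - fps_const (a * c * (b + d)) * (fps_X * H) +
      fps_const (a * c * (a * b * c * d)) * (fps_X * (fps_X * H)))"
    unfolding fps_compose_linear
    by (simp add: Let_def algebra_simps flip: fps_const_add fps_const_mult)
  have BG: "asc_conv n a b c d = qfac n * fps_nth G n" for n
    by (simp add: asc_conv_eq_fps_nth G_def)
  show ?thesis
  proof (cases j)
    case 0
    have "fps_nth G 0 = 1" using BG[of 0] by simp
    with arg_cong[OF eq, of "\<lambda>f. fps_nth f 1"] power_neq_1[of 1] show ?thesis
      by (simp add: Let_def 0 BG qfac_Suc algebra_simps)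
  next
    case (Suc i)
    from arg_cong[OF eq, of "\<lambda>f. fps_nth f (Suc (Suc i))"]
    have "(1 - qc ^ Suc (Suc i)) * fps_nth G (Suc (Suc i)) =
       ((a + c) - a * c * (b + d) * qc ^ Suc i) * fps_nth G (Suc i)
         - a * c * (1 - a * b * c * d * qc ^ i) * fps_nth G i"
      by (simp add: Let_def algebra_simps)
    hence "qfac (Suc i) * ((1 - qc ^ Suc (Suc i)) * fps_nth G (Suc (Suc i))) =
       qfac (Suc i) * (((a + c) - a * c * (b + d) * qc ^ Suc i) * fps_nth G (Suc i)
         - a * c * (1 - a * b * c * d * qc ^ i) * fps_nth G i)"
      by simp
    thus ?thesis
      unfolding Suc BG qfac_Suc[of "Suc i"] diff_Suc_1
      by (simp add: qfac_Suc algebra_simps)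
  qed
qed

text \<open>
  Replacing \<open>a\<close> by \<open>q a\<close> in the generating function \<open>(a b c s, a c d s)\<^sub>\<infinity> / (a s, c s)\<^sub>\<infinity>\<close>, and then multiplying by
  \<open>1 - c s\<close>, has the same effect as replacing \<open>s\<close> by \<open>q s\<close>. This is that identity, read off in
  the coefficients.
\<close>

lemma asc_conv_shift:
  "asc_conv j (qc * a) b c d = qc ^ j * asc_conv j a b c d + c * (1 - qc ^ j) * asc_conv (j - 1) (qc * a) b c d"
proof (cases j)
  case (Suc i)
  define u where "u = (\<lambda>k. qpoch (c * b) q k * a ^ k / qfac k)"
  define v where "v = (\<lambda>k. qpoch (a * d) q k * c ^ k / qfac k)"
  define w where "w = (\<lambda>k. qpoch (qc * a * d) q k * c ^ k / qfac k)"
  have B1: "asc_conv n a b c d = qfac n * (\<Sum>k\<le>n. u k * v (n - k))" for n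
    unfolding asc_conv_def u_def v_def sum_distrib_left
    by (rule sum.cong) (auto simp: qbinomial_eq mult_ac)
  have B2: "asc_conv n (qc * a) b c d = qfac n * (\<Sum>k\<le>n. qc ^ k * u k * w (n - k))" for n
    unfolding asc_conv_def u_def w_def sum_distrib_left
    by (rule sum.cong) (auto simp: qbinomial_eq power_mult_distrib mult_ac)
  have w: "w (Suc m) - c * w m = qc ^ Suc m * v (Suc m)" for m
  proof -
    have "qpoch (a * d) q (Suc m) = (1 - a * d) * qpoch (qc * a * d) q m"
      using qpoch_shift[of "a * d" q m] by (simp add: mult_ac)
    thus ?thesis
      using power_neq_1[of "Suc m"]
      by (simp add: w_def v_def qfac_Suc qpoch_Suc[of "qc * a * d"] divide_simps)
         (simp add: algebra_simps)
  qed
  have "(\<Sum>k\<le>Suc i. qc ^ k * u k * w (Suc i - k)) - c * (\<Sum>k\<le>i. qc ^ k * u k * w (i - k))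
     = qc ^ Suc i * u (Suc i) * w 0 + (\<Sum>k\<le>i. qc ^ k * u k * (w (Suc (i - k)) - c * w (i - k)))"
    by (simp add: sum_distrib_left right_diff_distrib sum_subtractf Suc_diff_le mult_ac)
  also have "\<dots> = qc ^ Suc i * u (Suc i) * v 0 + (\<Sum>k\<le>i. qc ^ k * u k * (qc ^ Suc (i - k) * v (Suc (i - k))))"
    unfolding w by (simp add: w_def v_def)
  also have "(\<Sum>k\<le>i. qc ^ k * u k * (qc ^ Suc (i - k) * v (Suc (i - k)))) =
      qc ^ Suc i * (\<Sum>k\<le>i. u k * v (Suc i - k))"
    unfolding sum_distrib_left
  proof (rule sum.cong)
    fix k assume k: "k \<in> {..i}"
    hence pw: "qc ^ k * qc ^ Suc (i - k) = qc ^ Suc i"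
      by (simp flip: power_add power_Suc)
    have "qc ^ k * u k * (qc ^ Suc (i - k) * v (Suc (i - k))) =
        (qc ^ k * qc ^ Suc (i - k)) * (u k * v (Suc (i - k)))"
      by (simp only: mult_ac)
    also have "\<dots> = qc ^ Suc i * (u k * v (Suc i - k))"
      unfolding pw using k by (simp add: Suc_diff_le)
    finally show "qc ^ k * u k * (qc ^ Suc (i - k) * v (Suc (i - k))) =
        qc ^ Suc i * (u k * v (Suc i - k))" .
  qed simp
  also have "qc ^ Suc i * u (Suc i) * v 0 + \<dots> = qc ^ Suc i * (\<Sum>k\<le>Suc i. u k * v (Suc i - k))"
    by (simp add: algebra_simps)
  finally show ?thesis
    unfolding Suc B1 B2 diff_Suc_1 qfac_Suc diff_eq_eq by (simp only: algebra_simps)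
qed simp

text \<open>
  Unlike \<open>asc_conv_shift\<close>, this expresses the dilated value by undilated ones only. The induction
  step substitutes the hypothesis into \<open>asc_conv_shift\<close> and eliminates the term of index \<open>j - 2\<close>
  by the three-term recurrence.
\<close>

lemma asc_conv_dilate:
  "(1 - a * b) * (1 - a * d) * asc_conv j (qc * a) b c d =
     (1 - a * (b + d) * qc ^ j + a ^ 2 * b * d * qc ^ j) * asc_conv j a b c d
     - a * (1 - qc ^ j) * (1 - a * b * c * d * qc ^ (j - 1)) * asc_conv (j - 1) a b c d"
proof (induction j)
  case 0
  show ?case by (simp add: algebra_simps power2_eq_square)
next
  case (Suc j)
  let ?y = "qc ^ j"
  let ?Z = "(1 - ?y) * (1 - a * b * c * d * qc ^ (j - 1)) * asc_conv (j - 1) a b c d"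
  have S: "asc_conv (Suc j) (qc * a) b c d = qc * ?y * asc_conv (Suc j) a b c d
      + c * (1 - qc * ?y) * asc_conv j (qc * a) b c d"
    using asc_conv_shift[of "Suc j" a b c d] by simp
  have T: "asc_conv (Suc j) a b c d = ((a + c) - a * c * (b + d) * ?y) * asc_conv j a b c d - a * c * ?Z"
    using asc_conv_recurrence[of j a b c d] by (simp only: mult_ac)
  have IH: "(1 - a * b) * (1 - a * d) * asc_conv j (qc * a) b c d =
     (1 - a * (b + d) * ?y + a ^ 2 * b * d * ?y) * asc_conv j a b c d - a * ?Z"
    using Suc.IH by (simp only: mult_ac)
  have "(1 - a * b) * (1 - a * d) * asc_conv (Suc j) (qc * a) b c d =
     (1 - a * (b + d) * (qc * ?y) + a ^ 2 * b * d * (qc * ?y)) * asc_conv (Suc j) a b c d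
     - a * (1 - qc * ?y) * (1 - a * b * c * d * ?y) * asc_conv j a b c d"
  proof -
    have "(1 - a * b) * (1 - a * d) * asc_conv (Suc j) (qc * a) b c d =
        (1 - a * b) * (1 - a * d) * (qc * ?y * asc_conv (Suc j) a b c d) +
        c * (1 - qc * ?y) * ((1 - a * b) * (1 - a * d) * asc_conv j (qc * a) b c d)"
      unfolding S by (simp add: algebra_simps)
    also have "\<dots> = (1 - a * b) * (1 - a * d) * (qc * ?y * asc_conv (Suc j) a b c d) +
        (1 - qc * ?y) * (c * (1 - a * (b + d) * ?y + a ^ 2 * b * d * ?y) * asc_conv j a b c d - a * c * ?Z)"
      unfolding IH by (simp add: algebra_simps)
    also have "a * c * ?Z = ((a + c) - a * c * (b + d) * ?y) * asc_conv j a b c d - asc_conv (Suc j) a b c d"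
      unfolding T by simp
    finally show ?thesis
      by (simp add: algebra_simps power2_eq_square)
  qed
  thus ?case by (simp only: power_Suc diff_Suc_1)
qed

text \<open>
  The value that the normalised Askey--Wilson integral assigns to the Al-Salam--Chihara polynomial
  \<open>Q\<^sub>j(x|b,d)\<close>.
\<close>

definition AW_coeff :: "nat \<Rightarrow> complex \<Rightarrow> complex \<Rightarrow> complex \<Rightarrow> complex \<Rightarrow> complex" where
  "AW_coeff j a b c d = qpoch (b * d) q j / qpoch (a * b * c * d) q j * asc_conv j a b c d"

text \<open>
  This is the equation that \<open>\<phi>\<^sub>h(x|q a) = (1 - 2 a x + a\<^sup>2) \<phi>\<^sub>h(x|a)\<close> forces on the integrals of
  polynomials with \<open>2 x Q\<^sub>j = Q\<^sub>j\<^sub>+\<^sub>1 + (b + d) q\<^sup>j Q\<^sub>j + (1 - b d q\<^sup>j\<^sup>-\<^sup>1) (1 - q\<^sup>j) Q\<^sub>j\<^sub>-\<^sub>1\<close>; the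
  prefactor on the left is the quotient of the normalising masses at \<open>q a\<close> and \<open>a\<close>.
\<close>

lemma AW_coeff_dilate:
  assumes "norm (a * b * c * d) < 1"
  shows "(1 - a * b) * (1 - a * c) * (1 - a * d) / (1 - a * b * c * d) * AW_coeff j (qc * a) b c d =
    (1 + a ^ 2 - a * (b + d) * qc ^ j) * AW_coeff j a b c d - a * AW_coeff (Suc j) a b c d
     - a * (1 - b * d * qc ^ (j - 1)) * (1 - qc ^ j) * AW_coeff (j - 1) a b c d"
proof -
  define e where "e = a * b * c * d"
  have nz: "qpoch e q n \<noteq> 0" for n
    using assms abs_q by (intro qpoch_nonzero) (auto simp: e_def)
  have nz1: "1 - e \<noteq> 0" "1 - e * qc ^ j \<noteq> 0"
    using nz[of 1] nz[of "Suc j"] by (auto simp: qpoch_Suc)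
  have sh: "qpoch (qc * a * b * c * d) q j = qpoch e q j * (1 - e * qc ^ j) / (1 - e)"
    using qpoch_shift[of e q j] nz1 by (simp add: e_def qpoch_Suc field_simps)
  let ?Z = "(1 - qc ^ j) * (1 - e * qc ^ (j - 1)) * asc_conv (j - 1) a b c d"
  have U: "(1 - a * b) * (1 - a * d) * asc_conv j (qc * a) b c d =
     (1 - a * (b + d) * qc ^ j + a ^ 2 * b * d * qc ^ j) * asc_conv j a b c d - a * ?Z"
    using asc_conv_dilate[of a b d j c] by (simp only: mult_ac e_def)
  have T: "asc_conv (Suc j) a b c d = ((a + c) - a * c * (b + d) * qc ^ j) * asc_conv j a b c d - a * c * ?Z"
    using asc_conv_recurrence[of j a b c d] by (simp only: mult_ac e_def)
  have key: "(1 - a * b) * (1 - a * c) * (1 - a * d) * asc_conv j (qc * a) b c d =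
     (1 + a ^ 2 - a * (b + d) * qc ^ j) * (1 - e * qc ^ j) * asc_conv j a b c d
     - a * (1 - b * d * qc ^ j) * asc_conv (Suc j) a b c d - a * (1 - e * qc ^ j) * ?Z"
  proof -
    have "(1 - a * b) * (1 - a * c) * (1 - a * d) * asc_conv j (qc * a) b c d =
        (1 - a * c) * ((1 - a * b) * (1 - a * d) * asc_conv j (qc * a) b c d)"
      by (simp only: mult_ac)
    thus ?thesis
      unfolding U T by (simp add: e_def algebra_simps power2_eq_square)
  qed
  have lower: "(1 - b * d * qc ^ (j - 1)) * (1 - qc ^ j) * AW_coeff (j - 1) a b c d =
      qpoch (b * d) q j / qpoch e q j * ?Z"
  proof (cases j)
    case (Suc i)
    have "1 - e * qc ^ i \<noteq> 0" using nz[of "Suc i"] by (auto simp: qpoch_Suc)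
    thus ?thesis using nz
      by (simp add: Suc AW_coeff_def qpoch_Suc flip: e_def)
  qed simp
  define w where "w = qpoch (b * d) q j / qpoch e q j"
  have M1: "AW_coeff j a b c d = w * asc_conv j a b c d" by (simp add: AW_coeff_def e_def w_def)
  have M2: "(1 - e * qc ^ j) * AW_coeff (Suc j) a b c d = w * (1 - b * d * qc ^ j) * asc_conv (Suc j) a b c d"
    using nz1 by (simp add: AW_coeff_def qpoch_Suc w_def flip: e_def)
  have M3: "(1 - e * qc ^ j) * AW_coeff j (qc * a) b c d = w * (1 - e) * asc_conv j (qc * a) b c d"
  proof -
    have "AW_coeff j (qc * a) b c d = qpoch (b * d) q j / (qpoch e q j * (1 - e * qc ^ j) / (1 - e)) * asc_conv j (qc * a) b c d"
      unfolding AW_coeff_def sh ..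
    thus ?thesis using nz1 nz[of j] by (simp add: w_def)
  qed
  have "(1 - e * qc ^ j) * ((1 - a * b) * (1 - a * c) * (1 - a * d) / (1 - e) * AW_coeff j (qc * a) b c d) =
    (1 - a * b) * (1 - a * c) * (1 - a * d) / (1 - e) * ((1 - e * qc ^ j) * AW_coeff j (qc * a) b c d)"
    by (simp only: mult_ac)
  also have "\<dots> = w * ((1 - a * b) * (1 - a * c) * (1 - a * d) * asc_conv j (qc * a) b c d)"
    unfolding M3 using nz1 by simp
  also have "\<dots> = (1 - e * qc ^ j) * ((1 + a ^ 2 - a * (b + d) * qc ^ j) * AW_coeff j a b c d
     - a * (w * ?Z)) - a * ((1 - e * qc ^ j) * AW_coeff (Suc j) a b c d)"
    unfolding key M1 M2 by (simp add: algebra_simps)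
  also have "\<dots> = (1 - e * qc ^ j) * ((1 + a ^ 2 - a * (b + d) * qc ^ j) * AW_coeff j a b c d
     - a * AW_coeff (Suc j) a b c d - a * (w * ?Z))"
    by (simp add: algebra_simps)
  finally have "(1 - a * b) * (1 - a * c) * (1 - a * d) / (1 - e) * AW_coeff j (qc * a) b c d =
     (1 + a ^ 2 - a * (b + d) * qc ^ j) * AW_coeff j a b c d - a * AW_coeff (Suc j) a b c d - a * (w * ?Z)"
    using nz1 by (simp only: mult_cancel_left) blast
  thus ?thesis
    using lower unfolding w_def e_def by (simp only: mult.assoc)
qed

lemma S2_eq_asc_conv: "S2 n b d q = asc_conv n b 0 d 0"
  by (simp add: S2_def asc_conv_def)

lemma S2_recurrence:
  "S2 (Suc n) b d q = (b + d) * S2 n b d q - b * d * (1 - qc ^ n) * S2 (n - 1) b d q"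
  using asc_conv_recurrence[of n b 0 d 0] by (simp add: S2_eq_asc_conv)

lemma S2_0 [simp]: "S2 0 b d q = 1"
  by (simp add: S2_eq_asc_conv)

lemma sigma4_eq:
  "sigma4 n a b c d q =
     (\<Sum>j\<le>n. of_real (qbinomial n j q) * S2 (n - j) b d q * AW_coeff j a b c d)"
  by (simp add: sigma4_def AW_coeff_def asc_conv_def mult_ac)

text \<open>
  The connection between Al-Salam--Chihara and \<open>q\<close>-Hermite polynomials, stated for arbitrary
  sequences: if multiplication by \<open>2 x\<close> acts on \<open>m\<close> like the Al-Salam--Chihara recurrence with
  parameters \<open>b, d\<close>, then it acts on \<open>s\<close> like the \<open>q\<close>-Hermite recurrence. Comparing the
  coefficients of \<open>m j\<close> leaves only the recurrence of \<^const>\<open>S2\<close>.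
\<close>

lemma S2_connection:
  fixes m :: "nat \<Rightarrow> complex" and b d :: complex
  defines "s \<equiv> (\<lambda>n. \<Sum>j\<le>n. of_real (qbinomial n j q) * S2 (n - j) b d q * m j)"
  shows "s (Suc n) + (1 - qc ^ n) * s (n - 1) =
    (\<Sum>j\<le>n. of_real (qbinomial n j q) * S2 (n - j) b d q *
       (m (Suc j) + (b + d) * qc ^ j * m j + (1 - b * d * qc ^ (j - 1)) * (1 - qc ^ j) * m (j - 1)))"
proof -
  define C where "C n j = of_real (qbinomial n j q) * S2 (n - j) b d q" for n j
  define g where "g j = (1 - b * d * qc ^ (j - 1)) * (1 - qc ^ j)" for j
  have C0: "C n j = 0" if "j > n" for n j
    using that by (simp add: C_def qbinomial_def)
  have s: "s k = (\<Sum>j\<le>Suc n. C k j * m j)" if "k \<le> Suc n" for k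
    unfolding s_def C_def[symmetric]
    by (rule sum.mono_neutral_left) (use that C0 in auto)
  have coeff: "C (Suc n) j + (1 - qc ^ n) * C (n - 1) j =
     (if j = 0 then 0 else C n (j - 1)) + (b + d) * qc ^ j * C n j + g (Suc j) * C n (Suc j)" for j
  proof (cases "j \<le> n")
    case False
    thus ?thesis
      by (cases "j = Suc n") (auto simp: C0, auto simp: C_def qbinomial_eq)
  next
    case True
    then obtain l where n: "n = j + l" using le_Suc_ex by blast
    \<comment> \<open>After division by the \<open>q\<close>-factorials the \<open>q\<close>-binomial coefficients disappear from the
      coefficient identity, apart from the common factor \<open>(q)\<^sub>n / (q)\<^sub>j\<close>.\<close>
    define r where "r k = S2 k b d q / qfac k" for k
    have C: "C (j + k) j = qfac (j + k) / qfac j * r k" for k j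
      by (simp add: C_def r_def qbinomial_eq)
    have C1: "(if j = 0 then 0 else C n (j - 1)) = qfac n / qfac j * (1 - qc ^ j) * r (Suc l)"
      using C[of "j - 1" "Suc l"] power_neq_1[of j]
      by (cases j) (auto simp: n qfac_Suc)
    have C2: "C (Suc n) j = qfac n / qfac j * (1 - qc ^ Suc n) * r (Suc l)"
      using C[of j "Suc l"] by (simp add: n qfac_Suc)
    have C3: "C n j = qfac n / qfac j * r l" using C by (simp add: n)
    have rec: "(1 - qc ^ Suc k) * r (Suc k) = (b + d) * r k - (if k = 0 then 0 else b * d * r (k - 1))" for k
    proof -
      have "1 - qc ^ Suc k \<noteq> 0" using power_neq_1[of "Suc k"] by simp
      hence "(1 - qc ^ Suc k) * r (Suc k) = S2 (Suc k) b d q / qfac k"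
        by (simp add: r_def qfac_Suc del: power_Suc)
      moreover have "(1 - qc ^ k) * S2 (k - 1) b d q / qfac k = (if k = 0 then 0 else r (k - 1))"
        using power_neq_1[of k] by (cases k) (auto simp: r_def qfac_Suc simp del: power_Suc)
      ultimately show ?thesis
        by (simp add: S2_recurrence r_def diff_divide_distrib mult.assoc flip: times_divide_eq_right)
    qed
    have "K * (1 - qc ^ Suc n) * R =
        K * (1 - qc ^ j) * R + K * qc ^ j * ((1 - qc ^ Suc l) * R)" for K R
      by (simp add: n power_add algebra_simps)
    note C2 = C2[unfolded this rec]
    show ?thesis
    proof (cases l)
      case 0
      have C4: "C n (Suc j) = 0" "(1 - qc ^ n) * C (n - 1) j = 0"
        using n 0 by (cases n; auto simp: C0)+
      show ?thesis unfolding C1 C2 C3 C4 using 0 by simp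
    next
      case (Suc i)
      have "C (n - 1) j = qfac (n - 1) / qfac j * r i"
        using C[of j i] by (simp add: n Suc)
      moreover have "qfac n = qfac (n - 1) * (1 - qc ^ n)"
        using qfac_Suc[of "n - 1"] by (simp add: n Suc)
      ultimately have C4: "(1 - qc ^ n) * C (n - 1) j = qfac n / qfac j * r i"
        by simp
      have C5: "g (Suc j) * C n (Suc j) = qfac n / qfac j * (1 - b * d * qc ^ j) * r i"
        using C[of "Suc j" i] power_neq_1[of "Suc j"] by (simp add: n Suc qfac_Suc g_def)
      show ?thesis
        unfolding C1 C2 C3 C4 C5 using Suc by (simp add: algebra_simps diff_divide_distrib)
    qed
  qed
  have "s (Suc n) + (1 - qc ^ n) * s (n - 1) =
     (\<Sum>j\<le>Suc n. (C (Suc n) j + (1 - qc ^ n) * C (n - 1) j) * m j)"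
    using s[of "Suc n"] s[of "n - 1"]
    by (simp add: sum_distrib_left distrib_right sum.distrib mult.assoc del: sum.atMost_Suc)
  also have "\<dots> = (\<Sum>j\<le>Suc n. (if j = 0 then 0 else C n (j - 1)) * m j)
       + (\<Sum>j\<le>Suc n. (b + d) * qc ^ j * C n j * m j) + (\<Sum>j\<le>Suc n. g (Suc j) * C n (Suc j) * m j)"
    unfolding coeff distrib_right sum.distrib ..
  also have "(\<Sum>j\<le>Suc n. (if j = 0 then 0 else C n (j - 1)) * m j) = (\<Sum>j\<le>n. C n j * m (Suc j))"
    by (simp add: sum.atMost_Suc_shift del: sum.atMost_Suc)
  also have "(\<Sum>j\<le>Suc n. (b + d) * qc ^ j * C n j * m j) = (\<Sum>j\<le>n. (b + d) * qc ^ j * C n j * m j)"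
    by (simp add: C0)
  also have "(\<Sum>j\<le>Suc n. g (Suc j) * C n (Suc j) * m j) = (\<Sum>j\<le>n. g j * C n j * m (j - 1))"
  proof -
    have "(\<Sum>j\<le>Suc n. g (Suc j) * C n (Suc j) * m j) = (\<Sum>j\<le>Suc (Suc n). g j * C n j * m (j - 1))"
      by (subst (2) sum.atMost_Suc_shift) (simp add: g_def)
    thus ?thesis by (simp add: C0)
  qed
  finally show ?thesis
    unfolding C_def[symmetric] g_def[symmetric]
    by (simp add: sum.distrib algebra_simps)
qed

lemma sigma4_dilate:
  assumes "norm (a * b * c * d) < 1"
  shows "(1 - a * b) * (1 - a * c) * (1 - a * d) / (1 - a * b * c * d) * sigma4 n (qc * a) b c d q =
    (1 + a ^ 2) * sigma4 n a b c d q - a * sigma4 (Suc n) a b c d q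
     - a * (1 - qc ^ n) * sigma4 (n - 1) a b c d q"
proof -
  let ?C = "\<lambda>j. of_real (qbinomial n j q) * S2 (n - j) b d q"
  have "(1 - a * b) * (1 - a * c) * (1 - a * d) / (1 - a * b * c * d) * sigma4 n (qc * a) b c d q =
    (\<Sum>j\<le>n. ?C j * ((1 - a * b) * (1 - a * c) * (1 - a * d) / (1 - a * b * c * d) * AW_coeff j (qc * a) b c d))"
    unfolding sigma4_eq sum_distrib_left by (simp add: mult_ac)
  also have "\<dots> = (1 + a ^ 2) * (\<Sum>j\<le>n. ?C j * AW_coeff j a b c d) -
      a * (\<Sum>j\<le>n. ?C j * (AW_coeff (Suc j) a b c d + (b + d) * qc ^ j * AW_coeff j a b c d +
        (1 - b * d * qc ^ (j - 1)) * (1 - qc ^ j) * AW_coeff (j - 1) a b c d))"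
    unfolding AW_coeff_dilate[OF assms] sum_distrib_left sum_subtractf[symmetric]
    by (rule sum.cong) (simp_all add: algebra_simps)
  also have "\<dots> = (1 + a ^ 2) * sigma4 n a b c d q - a * (sigma4 (Suc n) a b c d q +
     (1 - qc ^ n) * sigma4 (n - 1) a b c d q)"
    unfolding S2_connection sigma4_eq ..
  finally show ?thesis by (simp add: algebra_simps)
qed

end
section \<open>Infinite products and the dilation equation\<close>

lemma convergent_prod_qpoch:
  fixes z :: "'a :: {real_normed_field, banach}"
  assumes "\<bar>q\<bar> < 1"
  shows "convergent_prod (\<lambda>j. 1 - z * of_real q ^ j)"
proof (rule abs_convergent_prod_imp_convergent_prod)
  show "abs_convergent_prod (\<lambda>j. 1 - z * of_real q ^ j)"
    using assms by (auto simp: abs_convergent_prod_conv_summable norm_mult norm_power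
        intro!: summable_mult summable_geometric)
qed

lemma qpoch_LIMSEQ:
  fixes z :: "'a :: {real_normed_field, banach}"
  assumes "\<bar>q\<bar> < 1"
  shows "qpoch z q \<longlonglongrightarrow> qpoch_inf z q"
  using convergent_prod_LIMSEQ[OF convergent_prod_qpoch[OF assms, of z]]
  by (simp add: qpoch_def[abs_def] qpoch_inf_def LIMSEQ_lessThan_iff_atMost)

lemma of_real_qpoch_inf:
  assumes "\<bar>q\<bar> < 1"
  shows "of_real (qpoch_inf a q) = (qpoch_inf (of_real a) q :: complex)"
proof (rule LIMSEQ_unique)
  show "(\<lambda>n. of_real (qpoch a q n)) \<longlonglongrightarrow> (of_real (qpoch_inf a q) :: complex)"
    by (intro tendsto_of_real qpoch_LIMSEQ assms)
  show "(\<lambda>n. of_real (qpoch a q n)) \<longlonglongrightarrow> (qpoch_inf (of_real a) q :: complex)"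
    unfolding of_real_qpoch by (rule qpoch_LIMSEQ[OF assms])
qed

lemma one_minus_qpower_nonzero:
  fixes z :: complex
  assumes "\<bar>q\<bar> < 1" "norm z < 1"
  shows "1 - z * of_real q ^ j \<noteq> 0"
proof
  assume "1 - z * of_real q ^ j = 0"
  hence "qpoch z q (Suc j) = 0" by (simp add: qpoch_Suc)
  thus False using qpoch_nonzero[OF assms] by blast
qed

lemma qpoch_inf_nonzero:
  fixes z :: complex
  assumes "\<bar>q\<bar> < 1" "norm z < 1"
  shows "qpoch_inf z q \<noteq> 0"
  unfolding qpoch_inf_def
  using assms by (intro prodinf_nonzero convergent_prod_qpoch one_minus_qpower_nonzero)

lemma qpoch_inf_zero [simp]: "qpoch_inf 0 q = 1"
  by (simp add: qpoch_inf_def)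

lemma qpoch_inf_shift:
  fixes z :: complex
  assumes "\<bar>q\<bar> < 1"
  shows "qpoch_inf z q = (1 - z) * qpoch_inf (of_real q * z) q"
proof (rule LIMSEQ_unique)
  show "(\<lambda>n. qpoch z q (Suc n)) \<longlonglongrightarrow> qpoch_inf z q"
    by (rule LIMSEQ_Suc[OF qpoch_LIMSEQ[OF assms]])
  show "(\<lambda>n. qpoch z q (Suc n)) \<longlonglongrightarrow> (1 - z) * qpoch_inf (of_real q * z) q"
    unfolding qpoch_shift[symmetric] by (intro tendsto_mult tendsto_const qpoch_LIMSEQ[OF assms])
qed

text \<open>
  The partial products converge uniformly on the closed unit disc, with \<open>\<Sum>\<bar>q\<bar>\<^sup>n\<close> as majorant.
\<close>

lemma holomorphic_qpoch_inf:
  assumes "\<bar>q\<bar> < 1"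
  shows "(\<lambda>z. qpoch_inf z q) holomorphic_on ball 0 (1 :: real)"
proof -
  have "uniformly_convergent_on (cball 0 1 :: complex set) (\<lambda>N z. \<Prod>n<N. 1 - z * of_real q ^ n)"
  proof (rule uniformly_convergent_on_prod')
    show "uniformly_convergent_on (cball 0 1 :: complex set)
            (\<lambda>N z. \<Sum>n<N. norm (1 - z * of_real q ^ n - 1))"
    proof (rule Weierstrass_m_test')
      show "summable (\<lambda>n. \<bar>q\<bar> ^ n)" using assms by (intro summable_geometric) auto
    qed (auto simp: norm_mult norm_power intro!: mult_left_le_one_le)
  qed (auto intro!: continuous_intros)
  then obtain g where g: "uniform_limit (cball 0 1 :: complex set)
      (\<lambda>N z. qpoch z q N) g sequentially"
    by (auto simp: uniformly_convergent_on_def qpoch_def)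
  have eq: "g z = qpoch_inf z q" if "z \<in> cball 0 1" for z
    using LIMSEQ_unique[OF tendsto_uniform_limitI[OF g that] qpoch_LIMSEQ[OF assms]] .
  obtain "g holomorphic_on ball 0 1"
  proof (rule holomorphic_uniform_limit)
    show "\<forall>\<^sub>F n in sequentially. continuous_on (cball 0 1) (\<lambda>z. qpoch z q n)
       \<and> (\<lambda>z. qpoch z q n) holomorphic_on ball 0 (1 :: real)"
      by (auto simp: qpoch_def intro!: always_eventually continuous_intros holomorphic_intros)
  qed (use g in auto)
  thus ?thesis
    by (rule holomorphic_transform) (auto simp: eq)
qed

lemma holomorphic_qpoch_inf_mult:
  assumes "\<bar>q\<bar> < 1" "norm u \<le> 1"
  shows "(\<lambda>z. qpoch_inf (z * u) q) holomorphic_on ball 0 (1 :: real)"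
proof -
  have "((\<lambda>z. qpoch_inf z q) \<circ> (\<lambda>z. z * u)) holomorphic_on ball 0 (1 :: real)"
  proof (rule holomorphic_on_compose_gen)
    show "(\<lambda>z. z * u) ` ball 0 1 \<subseteq> ball 0 (1 :: real)"
    proof safe
      fix z :: complex assume "z \<in> ball 0 1"
      moreover have "norm z * norm u \<le> norm z"
        using assms(2) by (intro mult_left_le) auto
      ultimately show "z * u \<in> ball 0 1" by (simp add: norm_mult)
    qed
  qed (use holomorphic_qpoch_inf[OF assms(1)] in \<open>auto intro!: holomorphic_intros\<close>)
  thus ?thesis by (simp add: o_def)
qed

lemma norm_mult_less_1:
  fixes x y :: complex
  assumes "norm x < 1" "norm y < 1"
  shows "norm (x * y) < 1"
  using assms mult_strict_mono'[of "norm x" 1 "norm y" 1] by (simp add: norm_mult)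

context qbase
begin

text \<open>
  On the level of Taylor coefficients the dilation equation reads \<open>(q\<^sup>i - 1) d\<^sub>n\<^sub>,\<^sub>i = \<dots>\<close>, where the
  right-hand side involves only coefficients of index less than \<open>i\<close>, though of all functions
  \<open>D\<^sub>n\<^sub>-\<^sub>1, D\<^sub>n, D\<^sub>n\<^sub>+\<^sub>1\<close>. So induction on \<open>i\<close>, for all \<open>n\<close> at once, shows that they all vanish.
\<close>

lemma hermite_dilation_unique:
  fixes D :: "nat \<Rightarrow> complex \<Rightarrow> complex"
  assumes hol: "\<And>n. D n holomorphic_on ball 0 1"
  assumes zero: "\<And>n. D n 0 = 0"
  assumes dil: "\<And>n a. norm a < 1 \<Longrightarrow>
     D n (qc * a) = (1 + a ^ 2) * D n a - a * D (Suc n) a - a * (1 - qc ^ n) * D (n - 1) a"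
  assumes a: "norm a < 1"
  shows "D n a = 0"
proof -
  define G where "G n = fps_expansion (D n) 0" for n
  have G: "D n has_fps_expansion G n" for n
    unfolding G_def using hol by (intro has_fps_expansion_fps_expansion[of "ball 0 1"]) auto
  have eq: "fps_compose (G n) (fps_const qc * fps_X) =
     (1 + fps_X ^ 2) * G n - fps_X * G (Suc n) - fps_X * fps_const (1 - qc ^ n) * G (n - 1)" for n
  proof (rule fps_expansion_unique_complex)
    have "(D n \<circ> (\<lambda>a. qc * a)) has_fps_expansion fps_compose (G n) (fps_const qc * fps_X)"
      by (intro has_fps_expansion_compose fps_expansion_intros G) auto
    thus "(\<lambda>a. D n (qc * a)) has_fps_expansion fps_compose (G n) (fps_const qc * fps_X)"
      by (simp add: o_def)
    have "(\<lambda>a. (1 + a ^ 2) * D n a - a * D (Suc n) a - a * (1 - qc ^ n) * D (n - 1) a)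
       has_fps_expansion
       ((1 + fps_X ^ 2) * G n - fps_X * G (Suc n) - fps_X * fps_const (1 - qc ^ n) * G (n - 1))"
      by (intro fps_expansion_intros G)
    moreover have "\<forall>\<^sub>F a in nhds 0. D n (qc * a) =
        (1 + a ^ 2) * D n a - a * D (Suc n) a - a * (1 - qc ^ n) * D (n - 1) a"
      by (rule eventually_mono[OF eventually_nhds_in_open[of "ball 0 1"]]) (use dil in auto)
    ultimately show "(\<lambda>a. D n (qc * a)) has_fps_expansion
       ((1 + fps_X ^ 2) * G n - fps_X * G (Suc n) - fps_X * fps_const (1 - qc ^ n) * G (n - 1))"
      by (subst has_fps_expansion_cong[OF _ refl])
  qed
  have "\<forall>n. fps_nth (G n) i = 0" for i
  proof (induction i rule: less_induct)
    case (less i)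
    show ?case
    proof (cases i)
      case 0
      thus ?thesis
        using has_fps_expansion_imp_0_eq_fps_nth_0[OF G] zero by metis
    next
      case (Suc k)
      have "fps_nth (G n) i = 0" for n
      proof -
        have "qc ^ i * fps_nth (G n) i = fps_nth (fps_compose (G n) (fps_const qc * fps_X)) i"
          by (simp add: fps_compose_linear)
        also have "\<dots> = fps_nth (G n) i"
          unfolding eq using less Suc
          by (simp add: distrib_right power2_eq_square mult.assoc fps_X_mult_nth)
        finally show ?thesis
          using power_neq_1[of i] Suc by auto
      qed
      thus ?thesis by blast
    qed
  qed
  hence "G n = 0" by (intro fps_ext) auto
  with G[of n] have "D n has_fps_expansion 0" by simp
  thus ?thesis
    by (rule has_fps_expansion_0_analytic_continuation[OF _ hol]) (use a in auto)
qed

text \<open>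
  The integral of \<open>f\<^sub>h \<phi>\<^sub>h(\<cdot>|a) \<phi>\<^sub>h(\<cdot>|b) \<phi>\<^sub>h(\<cdot>|c) \<phi>\<^sub>h(\<cdot>|d)\<close>, that is, the reciprocal of the normalising
  factor of the Askey--Wilson density.
\<close>

definition AW_mass :: "complex \<Rightarrow> complex \<Rightarrow> complex \<Rightarrow> complex \<Rightarrow> complex" where
  "AW_mass a b c d = qpoch_inf (a * b * c * d) q /
     (qpoch_inf (a * b) q * qpoch_inf (a * c) q * qpoch_inf (a * d) q *
      qpoch_inf (b * c) q * qpoch_inf (b * d) q * qpoch_inf (c * d) q)"

lemma AW_mass_dilate:
  assumes "norm a < 1" "norm b < 1" "norm c < 1" "norm d < 1"
  shows "AW_mass (qc * a) b c d =
    AW_mass a b c d * ((1 - a * b) * (1 - a * c) * (1 - a * d) / (1 - a * b * c * d))"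
proof -
  have sh: "qpoch_inf (qc * a * u) q = qpoch_inf (a * u) q / (1 - a * u)" if "norm u < 1" for u
  proof -
    have "1 - a * u \<noteq> 0"
      using one_minus_qpower_nonzero[OF abs_q norm_mult_less_1[OF assms(1) that], of 0] by simp
    thus ?thesis
      using qpoch_inf_shift[OF abs_q, of "a * u"] by (simp add: field_simps)
  qed
  have "norm (b * c * d) < 1" using assms by (intro norm_mult_less_1)
  from sh[OF this] have sh4: "qpoch_inf (qc * a * b * c * d) q = qpoch_inf (a * b * c * d) q / (1 - a * b * c * d)"
    by (simp add: mult.assoc)
  show ?thesis
    unfolding AW_mass_def sh4 sh[OF assms(2)] sh[OF assms(3)] sh[OF assms(4)]
    by (simp add: field_simps)
qed

lemma AW_mass_nonzero:
  assumes "norm a < 1" "norm b < 1" "norm c < 1" "norm d < 1"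
  shows "AW_mass a b c d \<noteq> 0"
  unfolding AW_mass_def using assms
  by (simp add: qpoch_inf_nonzero abs_q norm_mult_less_1)

lemma AW_mass_sigma4_dilate:
  assumes "norm a < 1" "norm b < 1" "norm c < 1" "norm d < 1"
  defines "R \<equiv> \<lambda>n. \<lambda>z. AW_mass z b c d * sigma4 n z b c d q"
  shows "R n (qc * a) = (1 + a ^ 2) * R n a - a * R (Suc n) a - a * (1 - qc ^ n) * R (n - 1) a"
proof -
  have "norm (a * b * c * d) < 1" using assms by (intro norm_mult_less_1)
  from sigma4_dilate[OF this, of n] show ?thesis
    unfolding R_def AW_mass_dilate[OF assms(1-4)]
    by (simp only: mult.assoc) (simp add: algebra_simps)
qed

lemma holomorphic_AW_mass_sigma4:
  assumes "norm b < 1" "norm c < 1" "norm d < 1"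
  shows "(\<lambda>a. AW_mass a b c d * sigma4 n a b c d q) holomorphic_on ball 0 1"
proof -
  have mass: "(\<lambda>a. AW_mass a b c d) holomorphic_on ball 0 1"
    unfolding AW_mass_def mult.assoc using assms
    by (intro holomorphic_intros holomorphic_qpoch_inf_mult abs_q)
       (auto simp: qpoch_inf_nonzero abs_q norm_mult_less_1 less_imp_le)
  have "qpoch (a * b * c * d) q j \<noteq> 0" if "norm a < 1" for a j
    using assms that by (intro qpoch_nonzero abs_q norm_mult_less_1)
  hence "(\<lambda>a. sigma4 n a b c d q) holomorphic_on ball 0 1"
    unfolding sigma4_def qpoch_def by (intro holomorphic_intros) auto
  with mass show ?thesis by (rule holomorphic_on_mult)
qed

lemma asc_conv_zero_left: "asc_conv n 0 b c d = c ^ n"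
proof -
  have "asc_conv n 0 b c d = (\<Sum>k\<le>n. if k = 0 then c ^ n else 0)"
    unfolding asc_conv_def by (rule sum.cong) (auto simp: qbinomial_eq)
  thus ?thesis by simp
qed

lemma asc_conv_zero_third: "asc_conv n a b 0 d = a ^ n"
proof -
  have "asc_conv n a b 0 d = (\<Sum>k\<le>n. if k = n then a ^ n else 0)"
    unfolding asc_conv_def by (rule sum.cong) (auto simp: qbinomial_eq power_0_left)
  thus ?thesis by simp
qed

lemma S2_zero_right: "S2 n b 0 q = b ^ n"
  by (simp add: S2_eq_asc_conv asc_conv_zero_third)

text \<open>
  That \<^const>\<open>sigma4\<close> is symmetric in all four parameters becomes clear only from the integral. The
  removal of the parameters one by one needs the symmetry in degenerate cases, which are visible
  from the sum: this one, and those that follow from the next two lemmas.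
\<close>

lemma sigma4_first_third: "sigma4 n 0 b c d q = sigma4 n c b 0 d q"
  by (simp add: sigma4_eq AW_coeff_def asc_conv_zero_left asc_conv_zero_third)

lemma sigma4_zero_zero: "sigma4 n 0 b 0 d q = S2 n b d q"
proof -
  have "sigma4 n 0 b 0 d q = (\<Sum>j\<le>n. if j = 0 then S2 n b d q else 0)"
    unfolding sigma4_eq
    by (rule sum.cong) (auto simp: AW_coeff_def asc_conv_zero_left qbinomial_eq)
  thus ?thesis by simp
qed

lemma sigma4_two: "sigma4 n b d 0 0 q = S2 n b d q"
  by (simp add: sigma4_eq AW_coeff_def asc_conv_zero_third S2_zero_right)
     (simp add: S2_def mult_ac)

end
section \<open>The \<open>q\<close>-Hermite polynomials, their generating function and the Askey--Wilson integral\<close>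

lemma continuous_on_qhermite [continuous_intros]: "continuous_on A (\<lambda>x. qhermite n x q)"
proof (induction n rule: qhermite.induct[where ?P = "\<lambda>n _ _. continuous_on A (\<lambda>x. qhermite n x q)"])
qed (auto intro!: continuous_intros)

text \<open>
  For \<open>\<bar>x\<bar> \<le> 1\<close> the factors satisfy \<open>\<bar>l(x|y) - 1\<bar> = \<bar>y\<bar> \<bar>2 + y - 4 x\<^sup>2\<bar> \<le> 7 \<bar>y\<bar>\<close>, so the product
  converges uniformly.
\<close>

lemma uniform_limit_qhermite_l_prod:
  assumes "\<bar>q\<bar> < 1"
  shows "uniform_limit {-1..1} (\<lambda>N x. \<Prod>k<N. qhermite_l x (q ^ Suc k))
     (\<lambda>x. \<Prod>k. qhermite_l x (q ^ Suc k)) sequentially"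
proof -
  have bound: "\<bar>qhermite_l x (q ^ Suc k) - 1\<bar> \<le> 7 * \<bar>q\<bar> ^ k" if "x \<in> {-1..1}" for x k
  proof -
    define y where "y = q ^ Suc k"
    have y: "\<bar>y\<bar> \<le> \<bar>q\<bar> ^ k" "\<bar>y\<bar> \<le> 1"
      using assms by (auto simp: y_def power_abs abs_mult mult_left_le_one_le power_le_one mult_le_one)
    have x2: "x ^ 2 \<le> 1" using that by (simp add: abs_square_le_1 abs_le_iff)
    have "qhermite_l x y - 1 = y * (2 + y - 4 * x ^ 2)"
      by (simp add: qhermite_l_def power2_eq_square algebra_simps)
    moreover have "\<bar>2 + y - 4 * x ^ 2\<bar> \<le> 7" using x2 y zero_le_power2[of x] by linarith
    ultimately have "\<bar>qhermite_l x y - 1\<bar> \<le> \<bar>y\<bar> * 7"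
      by (simp add: abs_mult mult_left_mono)
    thus ?thesis using y by (simp add: y_def)
  qed
  have sm: "summable (\<lambda>k. 7 * \<bar>q\<bar> ^ k)"
    using assms by (intro summable_mult summable_geometric) auto
  have "uniformly_convergent_on {-1..1} (\<lambda>N x. \<Prod>k<N. qhermite_l x (q ^ Suc k))"
  proof (rule uniformly_convergent_on_prod')
    show "uniformly_convergent_on {-1..1} (\<lambda>N x. \<Sum>n<N. norm (qhermite_l x (q ^ Suc n) - 1))"
      by (rule Weierstrass_m_test'[OF _ sm]) (use bound in auto)
  qed (auto simp: qhermite_l_def intro!: continuous_intros)
  then obtain g where g: "uniform_limit {-1..1} (\<lambda>N x. \<Prod>k<N. qhermite_l x (q ^ Suc k)) g sequentially"
    by (auto simp: uniformly_convergent_on_def)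
  have eq: "g x = (\<Prod>k. qhermite_l x (q ^ Suc k))" if x: "x \<in> {-1..1}" for x
  proof (rule LIMSEQ_unique[OF tendsto_uniform_limitI[OF g x]])
    have "convergent_prod (\<lambda>k. qhermite_l x (q ^ Suc k))"
      by (rule abs_convergent_prod_imp_convergent_prod, unfold abs_convergent_prod_conv_summable,
          rule summable_comparison_test'[OF sm]) (use bound x in auto)
    from convergent_prod_LIMSEQ[OF this]
    show "(\<lambda>N. \<Prod>k<N. qhermite_l x (q ^ Suc k)) \<longlonglongrightarrow> (\<Prod>k. qhermite_l x (q ^ Suc k))"
      by (simp add: LIMSEQ_lessThan_iff_atMost)
  qed
  show ?thesis
    by (rule uniform_limit_cong'[THEN iffD1, OF _ _ g]) (auto simp: eq)
qed

lemma continuous_on_qhermite_density: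
  assumes "\<bar>q\<bar> < 1"
  shows "continuous_on {-1..1} (\<lambda>x. qhermite_density x q)"
proof -
  have "continuous_on {-1..1} (\<lambda>x. \<Prod>k. qhermite_l x (q ^ Suc k))"
    by (rule uniform_limit_theorem[OF _ uniform_limit_qhermite_l_prod[OF assms]])
       (auto simp: qhermite_l_def intro!: always_eventually continuous_intros)
  thus ?thesis
    unfolding qhermite_density_def by (intro continuous_intros) auto
qed

context qbase
begin

text \<open>
  Rogers' formula: with \<open>z = e\<^sup>i\<^sup>t\<close> the recurrence of \<open>S2 n z (1 / z)\<close> becomes the
  one that defines the \<open>q\<close>-Hermite polynomials, because \<open>z + 1 / z = 2 cos t\<close>.
\<close>

lemma qhermite_cos: "complex_of_real (qhermite n (cos t) q) = S2 n (cis t) (cis (- t)) q"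
proof (induction n rule: qhermite.induct[where ?P =
      "\<lambda>n _ _. complex_of_real (qhermite n (cos t) q) = S2 n (cis t) (cis (- t)) q"])
  case (2 x q)
  show ?case using S2_recurrence[of 0 "cis t" "cis (- t)"]
    by (simp add: complex_eq_iff)
next
  case (3 n x q')
  have "cis t + cis (- t) = of_real (2 * cos t)" by (simp add: complex_eq_iff)
  thus ?case using S2_recurrence[of "Suc n" "cis t" "cis (- t)"] 3
    by (simp add: cis_mult)
qed simp

lemma qhermite_cos_sum:
  "qhermite n (cos t) q = (\<Sum>k\<le>n. qbinomial n k q * cos ((real n - 2 * real k) * t))"
proof -
  have "cis t ^ k * cis (- t) ^ (n - k) = cis (- ((real n - 2 * real k) * t))" if "k \<le> n" for k
    unfolding Complex.DeMoivre cis_mult using that by (simp add: of_nat_diff algebra_simps)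
  hence "complex_of_real (qhermite n (cos t) q) =
    (\<Sum>k\<le>n. of_real (qbinomial n k q) * cis (- ((real n - 2 * real k) * t)))"
    unfolding qhermite_cos S2_def by (intro sum.cong) (auto simp: mult.assoc)
  from arg_cong[OF this, of Re] show ?thesis by simp
qed

lemma qfac_inverse_bounded: "\<exists>C. \<forall>n. norm (inverse (qfac n)) \<le> C"
proof -
  have "qpoch_inf qc q \<noteq> 0" using abs_q by (intro qpoch_inf_nonzero) auto
  hence "(\<lambda>n. inverse (qfac n)) \<longlonglongrightarrow> inverse (qpoch_inf qc q)"
    using qpoch_LIMSEQ[OF abs_q] by (intro tendsto_inverse)
  hence "Bseq (\<lambda>n. inverse (qfac n))" using convergentI convergent_imp_Bseq by blast
  thus ?thesis by (auto simp: Bseq_def)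
qed

text \<open>
  The \<open>n + 1\<close> summands in Rogers' formula are bounded, because \<open>(q)\<^sub>n\<close> tends to a nonzero limit.
  Linear growth makes the generating function converge on the whole unit disc.
\<close>

lemma qhermite_bound:
  "\<exists>C. \<forall>n. \<forall>x\<in>{-1..1}. norm (of_real (qhermite n x q) / qfac n) \<le> C * (real n + 1)"
proof -
  obtain C where C: "norm (inverse (qfac n)) \<le> C" for n using qfac_inverse_bounded by blast
  have C0: "C \<ge> 0" using C[of 0] norm_ge_zero order_trans by blast
  have "norm (of_real (qhermite n x q) / qfac n) \<le> C ^ 2 * (real n + 1)" if x: "x \<in> {-1..1}" for n x
  proof -
    define t where "t = arccos x"
    have x: "x = cos t" using x by (simp add: t_def)
    have "of_real (qhermite n x q) / qfac n =
        (\<Sum>k\<le>n. inverse (qfac (n - k)) * inverse (qfac k) * (cis t ^ k * cis (- t) ^ (n - k)))"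
      unfolding x qhermite_cos S2_def sum_divide_distrib
      by (rule sum.cong) (auto simp: qbinomial_eq field_simps)
    also have "norm \<dots> \<le> (\<Sum>k\<le>n. C * C)"
    proof (rule sum_norm_le)
      fix k
      show "norm (inverse (qfac (n - k)) * inverse (qfac k) * (cis t ^ k * cis (- t) ^ (n - k))) \<le> C * C"
        unfolding norm_mult norm_power norm_cis using C C0 by (simp add: mult_mono)
    qed
    finally show ?thesis by (simp add: power2_eq_square algebra_simps)
  qed
  thus ?thesis by blast
qed

lemma qhermite_gf_uniform:
  assumes "norm t < 1"
  shows "uniform_limit {-1..1} (\<lambda>N x. \<Sum>j<N. t ^ j / qfac j * of_real (qhermite j x q))
    (\<lambda>x. qhermite_gf x t q) sequentially"
proof -
  obtain C where C: "norm (of_real (qhermite n x q) / qfac n) \<le> C * (real n + 1)"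
    if "x \<in> {-1..1}" for n x
    using qhermite_bound by blast
  have "summable (\<lambda>n. C * (of_nat (Suc n) * norm t ^ n))"
    using geometric_deriv_sums[of "norm t"] assms by (intro summable_mult) (auto simp: sums_iff)
  hence sm: "summable (\<lambda>n. C * (real n + 1) * norm t ^ n)" by (simp add: mult_ac add_ac)
  show ?thesis
    unfolding qhermite_gf_def of_real_qpoch
  proof (rule Weierstrass_m_test[OF _ sm])
    fix n x assume "x \<in> {- 1..1 :: real}"
    from mult_left_mono[OF C[OF this, of n], of "norm t ^ n"]
    show "norm (t ^ n / qfac n * of_real (qhermite n x q)) \<le> C * (real n + 1) * norm t ^ n"
      by (simp add: norm_mult norm_divide norm_power mult_ac)
  qed
qed

lemma qhermite_gf_sums:
  assumes "norm t < 1" "x \<in> {-1..1}"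
  shows "(\<lambda>j. t ^ j / qfac j * of_real (qhermite j x q)) sums qhermite_gf x t q"
  unfolding sums_def using tendsto_uniform_limitI[OF qhermite_gf_uniform[OF assms(1)] assms(2)] .

lemma continuous_on_qhermite_gf:
  assumes "norm t < 1"
  shows "continuous_on {-1..1} (\<lambda>x. qhermite_gf x t q)"
  by (rule uniform_limit_theorem[OF _ qhermite_gf_uniform[OF assms]])
     (auto intro!: always_eventually continuous_intros)

lemma qhermite_gf_0 [simp]: "qhermite_gf x 0 q = 1"
proof -
  have "(\<lambda>j. 0 ^ j / of_real (qpoch q q j) * complex_of_real (qhermite j x q)) sums 1"
    using sums_single[of 0 "\<lambda>j. 1 :: complex"]
    by (rule sums_cong[THEN iffD1, rotated]) auto
  thus ?thesis by (simp add: qhermite_gf_def sums_iff)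
qed

text \<open>
  This is \<open>\<phi>\<^sub>h(x|t) = 1 / \<Prod>v(x|t q\<^sup>k)\<close> in the form that is needed: the coefficient of \<open>t\<^sup>j\<^sup>+\<^sup>2\<close> is the
  three-term recurrence divided by \<open>(q)\<^sub>j\<^sub>+\<^sub>1\<close>.
\<close>

lemma qhermite_gf_dilate:
  assumes t: "norm t < 1" and x: "x \<in> {-1..1}"
  shows "qhermite_gf x (qc * t) q = (1 + t ^ 2 - 2 * of_real x * t) * qhermite_gf x t q"
proof -
  define g where "g j = complex_of_real (qhermite j x q) / qfac j" for j
  let ?p = "qhermite_gf x t q"
  have qt: "norm (qc * t) < 1"
    using t abs_q by (intro norm_mult_less_1) auto
  have g0: "g 0 = 1" by (simp add: g_def)
  have g1: "(1 - qc) * g 1 = 2 * of_real x"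
    using power_neq_1[of 1] by (simp add: g_def qpoch_Suc)
  have rec: "(1 - qc ^ Suc (Suc j)) * g (Suc (Suc j)) = 2 * of_real x * g (Suc j) - g j" for j
  proof -
    have nz: "1 - qc ^ Suc i \<noteq> 0" for i using power_neq_1[of "Suc i"] by simp
    have "g j = (1 - qc ^ Suc j) * of_real (qhermite j x q) / qfac (Suc j)"
      using nz[of j] by (simp add: g_def qfac_Suc del: power_Suc)
    moreover have "(1 - qc ^ Suc (Suc j)) * g (Suc (Suc j)) =
        of_real (qhermite (Suc (Suc j)) x q) / qfac (Suc j)"
      using nz[of "Suc j"] by (simp add: g_def qfac_Suc[of "Suc j"] del: power_Suc qhermite.simps)
    ultimately show ?thesis
      by (simp add: g_def diff_divide_distrib)
  qed
  have s: "(\<lambda>j. t ^ j * g j) sums ?p"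
    using qhermite_gf_sums[OF t x] by (simp add: g_def)
  have s': "(\<lambda>j. t ^ Suc j * g (Suc j)) sums (?p - 1)"
    using s by (subst sums_Suc_iff) (simp add: g0)
  have "(\<lambda>j. (qc * t) ^ j * g j) sums qhermite_gf x (qc * t) q"
    using qhermite_gf_sums[OF qt x] by (simp add: g_def)
  hence "(\<lambda>j. t ^ j * g j - (qc * t) ^ j * g j) sums (?p - qhermite_gf x (qc * t) q)"
    using s by (intro sums_diff)
  moreover define f where "f j = (1 - qc ^ j) * (t ^ j * g j)" for j
  ultimately have "f sums (?p - qhermite_gf x (qc * t) q)"
    by (simp add: f_def[abs_def] power_mult_distrib algebra_simps)
  hence "(\<lambda>j. f (Suc j)) sums (?p - qhermite_gf x (qc * t) q)"
    by (subst sums_Suc_iff) (simp add: f_def)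
  moreover have "f 1 = 2 * of_real x * t"
    using arg_cong[OF g1, of "\<lambda>y. y * t"] by (simp add: f_def mult_ac)
  ultimately have "(\<lambda>j. f (Suc (Suc j))) sums (?p - qhermite_gf x (qc * t) q - 2 * of_real x * t)"
    by (subst sums_Suc_iff) simp
  hence "(\<lambda>j. (1 - qc ^ Suc (Suc j)) * (t ^ Suc (Suc j) * g (Suc (Suc j)))) sums
    (?p - qhermite_gf x (qc * t) q - 2 * of_real x * t)"
    by (simp only: f_def)
  moreover have "(\<lambda>j. 2 * of_real x * t * (t ^ Suc j * g (Suc j)) - t ^ 2 * (t ^ j * g j)) sums
     (2 * of_real x * t * (?p - 1) - t ^ 2 * ?p)"
    by (intro sums_diff sums_mult s s')
  moreover have "(1 - qc ^ Suc (Suc j)) * (t ^ Suc (Suc j) * g (Suc (Suc j))) =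
      2 * of_real x * t * (t ^ Suc j * g (Suc j)) - t ^ 2 * (t ^ j * g j)" for j
  proof -
    have "(1 - qc ^ Suc (Suc j)) * (t ^ Suc (Suc j) * g (Suc (Suc j))) =
        t ^ Suc (Suc j) * ((1 - qc ^ Suc (Suc j)) * g (Suc (Suc j)))" by (simp only: mult_ac)
    thus ?thesis unfolding rec by (simp add: algebra_simps power2_eq_square)
  qed
  ultimately have "?p - qhermite_gf x (qc * t) q - 2 * of_real x * t =
      2 * of_real x * t * (?p - 1) - t ^ 2 * ?p"
    using sums_unique2 by (metis (no_types, lifting) sums_cong)
  thus ?thesis by (simp add: algebra_simps)
qed

lemma qhermite_gf_integral_sums:
  assumes t: "norm t < 1" and K: "continuous_on {-1..1} K"
  shows "(\<lambda>j. integral {-1..1} (\<lambda>x. of_real (qhermite j x q) / qfac j * K x) * t ^ j) sums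
     integral {-1..1} (\<lambda>x. qhermite_gf x t q * K x)"
proof -
  let ?T = "\<lambda>j x. t ^ j / qfac j * of_real (qhermite j x q) * K x"
  have bd: "bounded (f ` {-1..1})" if "continuous_on {-1..1} f" for f :: "real \<Rightarrow> complex"
    using that by (intro compact_imp_bounded compact_continuous_image) auto
  have "uniform_limit {-1..1} (\<lambda>N x. (\<Sum>j<N. t ^ j / qfac j * of_real (qhermite j x q)) * K x)
    (\<lambda>x. qhermite_gf x t q * K x) sequentially"
    using K continuous_on_qhermite_gf[OF t]
    by (intro uniform_lim_mult qhermite_gf_uniform t bd uniform_limit_const)
  then obtain I L where I: "\<And>N. ((\<lambda>x. (\<Sum>j<N. t ^ j / qfac j * of_real (qhermite j x q)) * K x) has_integral I N) {-1..1}"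
    and L: "((\<lambda>x. qhermite_gf x t q * K x) has_integral L) {-1..1}" and lim: "I \<longlonglongrightarrow> L"
    by (rule uniform_limit_integral) (use K in \<open>auto intro!: continuous_intros\<close>)
  have IN: "I N = (\<Sum>j<N. integral {-1..1} (\<lambda>x. of_real (qhermite j x q) / qfac j * K x) * t ^ j)" for N
  proof -
    have "I N = integral {-1..1} (\<lambda>x. \<Sum>j<N. t ^ j * (of_real (qhermite j x q) / qfac j * K x))"
      using integral_unique[OF I[of N]] by (simp add: sum_distrib_right mult.assoc)
    also have "\<dots> = (\<Sum>j<N. integral {-1..1} (\<lambda>x. t ^ j * (of_real (qhermite j x q) / qfac j * K x)))"
      using K by (intro integral_sum integrable_continuous_real) (auto intro!: continuous_intros)
    finally show ?thesis unfolding integral_mult_right by (simp only: mult_ac)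
  qed
  show ?thesis
    unfolding sums_def integral_unique[OF L] IN[symmetric] by (rule lim)
qed

text \<open>
  The first generating function stands apart because the integral is studied as a power series in
  \<open>a\<close>, the rest of the integrand being the fixed continuous kernel.
\<close>

definition AW_integral :: "nat \<Rightarrow> complex \<Rightarrow> complex \<Rightarrow> complex \<Rightarrow> complex \<Rightarrow> complex" where
  "AW_integral n a b c d = integral {-1..1} (\<lambda>x. qhermite_gf x a q * (of_real (qhermite n x q) *
     of_real (qhermite_density x q) * qhermite_gf x b q * qhermite_gf x c q * qhermite_gf x d q))"

lemma AW_integral_swap:
  "AW_integral n a b c d = AW_integral n c b a d" "AW_integral n a b c d = AW_integral n b d c a" "AW_integral n a b c d = AW_integral n b a c d"
  by (simp_all add: AW_integral_def mult_ac)

lemma continuous_on_AW_integral_kernel: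
  assumes "norm b < 1" "norm c < 1" "norm d < 1"
  shows "continuous_on {-1..1} (\<lambda>x. complex_of_real (qhermite n x q) *
     of_real (qhermite_density x q) * qhermite_gf x b q * qhermite_gf x c q * qhermite_gf x d q)"
  using assms abs_q
  by (intro continuous_intros continuous_on_qhermite_gf continuous_on_qhermite_density)

lemma holomorphic_AW_integral:
  assumes "norm b < 1" "norm c < 1" "norm d < 1"
  shows "(\<lambda>a. AW_integral n a b c d) holomorphic_on ball 0 1"
  unfolding AW_integral_def
  by (rule power_series_holomorphic, simp,
      rule qhermite_gf_integral_sums[OF _ continuous_on_AW_integral_kernel[OF assms]], simp)

lemma qhermite_times_x:
  "2 * x * qhermite n x q = qhermite (Suc n) x q + (1 - q ^ n) * qhermite (n - 1) x q"
  by (cases n) auto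

text \<open>
  The functional equation of the generating function brings in the factor \<open>2 x\<close>, which the
  three-term recurrence turns into a change of \<open>n\<close>.
\<close>

lemma AW_integral_dilate:
  assumes "norm a < 1" "norm b < 1" "norm c < 1" "norm d < 1"
  shows "AW_integral n (qc * a) b c d =
    (1 + a ^ 2) * AW_integral n a b c d - a * AW_integral (Suc n) a b c d - a * (1 - qc ^ n) * AW_integral (n - 1) a b c d"
proof -
  define w where "w x = qhermite_gf x a q * (of_real (qhermite_density x q) *
     qhermite_gf x b q * qhermite_gf x c q * qhermite_gf x d q)" for x
  have AW_integral: "AW_integral m a b c d = integral {-1..1} (\<lambda>x. of_real (qhermite m x q) * w x)" for m
    unfolding AW_integral_def w_def by (simp add: mult_ac)
  have "continuous_on {-1..1} w"
    unfolding w_def using assms abs_q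
    by (intro continuous_intros continuous_on_qhermite_gf continuous_on_qhermite_density)
  hence I: "(\<lambda>x. k * (complex_of_real (qhermite m x q) * w x)) integrable_on {-1..1}" for m k
    by (intro integrable_continuous_real continuous_intros)
  have "AW_integral n (qc * a) b c d = integral {-1..1} (\<lambda>x.
     (1 + a ^ 2) * (of_real (qhermite n x q) * w x) - a * (of_real (qhermite (Suc n) x q) * w x)
      - a * (1 - qc ^ n) * (of_real (qhermite (n - 1) x q) * w x))"
    unfolding AW_integral_def
  proof (rule integral_cong)
    fix x :: real assume x: "x \<in> {-1..1}"
    have h: "2 * of_real x * complex_of_real (qhermite n x q) =
        of_real (qhermite (Suc n) x q) + (1 - qc ^ n) * of_real (qhermite (n - 1) x q)"
      using arg_cong[OF qhermite_times_x[of x n], of complex_of_real] by simp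
    have "qhermite_gf x (qc * a) q * (of_real (qhermite n x q) *
     of_real (qhermite_density x q) * qhermite_gf x b q * qhermite_gf x c q * qhermite_gf x d q)
     = (1 + a ^ 2) * (of_real (qhermite n x q) * w x) -
       a * (2 * of_real x * complex_of_real (qhermite n x q)) * w x"
      unfolding qhermite_gf_dilate[OF assms(1) x] w_def by (simp add: algebra_simps)
    also have "\<dots> = (1 + a ^ 2) * (of_real (qhermite n x q) * w x) - a * (of_real (qhermite (Suc n) x q) * w x)
      - a * (1 - qc ^ n) * (of_real (qhermite (n - 1) x q) * w x)"
      unfolding h by (simp add: algebra_simps)
    finally show "qhermite_gf x (qc * a) q * (of_real (qhermite n x q) *
     of_real (qhermite_density x q) * qhermite_gf x b q * qhermite_gf x c q * qhermite_gf x d q) = \<dots>" .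
  qed
  also have "\<dots> = (1 + a ^ 2) * AW_integral n a b c d - a * AW_integral (Suc n) a b c d - a * (1 - qc ^ n) * AW_integral (n - 1) a b c d"
    unfolding AW_integral by (subst integral_diff integral_mult_right | intro integrable_diff I)+ simp
  finally show ?thesis .
qed

text \<open>
  Both sides are holomorphic in \<open>a\<close> and satisfy the dilation equation, which determines them
  by their values at \<open>a = 0\<close>.
\<close>

lemma AW_integral_extend:
  assumes "norm b < 1" "norm c < 1" "norm d < 1"
  assumes "\<And>n. AW_integral n 0 b c d = AW_mass 0 b c d * sigma4 n 0 b c d q"
  assumes "norm a < 1"
  shows "AW_integral n a b c d = AW_mass a b c d * sigma4 n a b c d q"
proof -
  define R where "R n z = AW_mass z b c d * sigma4 n z b c d q" for n z
  have "AW_integral n a b c d - R n a = 0"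
  proof (rule hermite_dilation_unique[where D = "\<lambda>n z. AW_integral n z b c d - R n z"])
    fix n show "(\<lambda>z. AW_integral n z b c d - R n z) holomorphic_on ball 0 1"
      unfolding R_def using assms by (intro holomorphic_on_diff holomorphic_AW_integral holomorphic_AW_mass_sigma4)
  next
    fix n and z :: complex assume z: "norm z < 1"
    show "AW_integral n (qc * z) b c d - R n (qc * z) = (1 + z ^ 2) * (AW_integral n z b c d - R n z) -
      z * (AW_integral (Suc n) z b c d - R (Suc n) z) - z * (1 - qc ^ n) * (AW_integral (n - 1) z b c d - R (n - 1) z)"
      using AW_integral_dilate[OF z assms(1-3), of n] AW_mass_sigma4_dilate[OF z assms(1-3), of n]
      unfolding R_def by (simp only:) (simp add: algebra_simps)
  qed (use assms in \<open>auto simp: R_def\<close>)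
  thus ?thesis by (simp add: R_def)
qed

lemma AW_mass_first_third: "AW_mass 0 b c d = AW_mass c b 0 d"
  by (simp add: AW_mass_def mult_ac)

lemma AW_mass_two: "AW_mass 0 b 0 d = AW_mass b d 0 0"
  by (simp add: AW_mass_def mult_ac)

text \<open>
  The parameters are removed along the chain
  \<open>(a,b,c,d) \<leadsto> (0,b,c,d) \<sim> (c,b,0,d) \<leadsto> (0,b,0,d) \<sim> (b,d,0,0) \<leadsto> (0,d,0,0) \<sim> (d,0,0,0) \<leadsto> (0,0,0,0)\<close>,
  where \<open>\<leadsto>\<close> is \<open>AW_integral_extend\<close> and \<open>\<sim>\<close> permutes the parameters of the integral.
\<close>

lemma AW_integral_eval:
  assumes base: "\<And>n. AW_integral n 0 0 0 0 = (if n = 0 then 1 else 0)"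
  assumes "norm a < 1" "norm b < 1" "norm c < 1" "norm d < 1"
  shows "AW_integral n a b c d = AW_mass a b c d * sigma4 n a b c d q"
proof -
  have 0: "AW_integral n 0 0 0 0 = AW_mass 0 0 0 0 * sigma4 n 0 0 0 0 q" for n
    by (simp add: base sigma4_zero_zero S2_zero_right AW_mass_def power_0_left)
  have 1: "AW_integral n z 0 0 0 = AW_mass z 0 0 0 * sigma4 n z 0 0 0 q" if "norm z < 1" for n z
    by (rule AW_integral_extend[OF _ _ _ 0 that]) auto
  have 2: "AW_integral n y z 0 0 = AW_mass y z 0 0 * sigma4 n y z 0 0 q" if "norm y < 1" "norm z < 1" for n y z
  proof (rule AW_integral_extend)
    fix n
    have "AW_integral n 0 z 0 0 = AW_integral n z 0 0 0" by (rule AW_integral_swap)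
    thus "AW_integral n 0 z 0 0 = AW_mass 0 z 0 0 * sigma4 n 0 z 0 0 q"
      using 1[of z n] that
      by (simp add: sigma4_zero_zero[of n z 0] sigma4_two[of n z 0] AW_mass_two[of z 0])
  qed (use that in auto)
  have 3: "AW_integral n y b 0 d = AW_mass y b 0 d * sigma4 n y b 0 d q" if "norm y < 1" for n y
  proof (rule AW_integral_extend)
    fix n
    have "AW_integral n 0 b 0 d = AW_integral n b d 0 0" by (rule AW_integral_swap)
    thus "AW_integral n 0 b 0 d = AW_mass 0 b 0 d * sigma4 n 0 b 0 d q"
      using 2[of b d n] assms by (simp add: sigma4_zero_zero sigma4_two AW_mass_two)
  qed (use that assms in auto)
  show ?thesis
  proof (rule AW_integral_extend)
    fix n
    have "AW_integral n 0 b c d = AW_integral n c b 0 d" by (rule AW_integral_swap)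
    thus "AW_integral n 0 b c d = AW_mass 0 b c d * sigma4 n 0 b c d q"
      using 3[of c n] assms by (simp add: sigma4_first_third AW_mass_first_third)
  qed (use assms in auto)
qed

end
section \<open>Moments of the \<open>q\<close>-Hermite density\<close>

lemma integral_cos_multiple:
  "integral {0..pi} (\<lambda>t. cos (of_int m * t)) = (if m = 0 then pi else 0)"
proof (cases "m = 0")
  case False
  have "((\<lambda>t. cos (of_int m * t)) has_integral sin (of_int m * pi) / of_int m - sin (of_int m * 0) / of_int m) {0..pi}"
    using False
    by (intro fundamental_theorem_of_calculus)
       (auto intro!: derivative_eq_intros simp flip: has_real_derivative_iff_has_vector_derivative)
  thus ?thesis using False by (simp add: integral_unique sin_integer_2pi mult.commute[of _ pi])
qed simp

lemma integral_sqrt_substitution: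
  fixes p :: "real \<Rightarrow> real"
  assumes "continuous_on {-1..1} p"
  shows "integral {-1..1} (\<lambda>x. p x * sqrt (1 - x\<^sup>2)) = integral {0..pi} (\<lambda>t. p (cos t) * (sin t)\<^sup>2)"
proof -
  let ?f = "\<lambda>x. p x * sqrt (1 - x\<^sup>2)"
  have "((\<lambda>t. - sin t *\<^sub>R ?f (cos t)) has_integral
      integral {cos 0..cos pi} ?f - integral {cos pi..cos 0} ?f) {0..pi}"
    by (rule has_integral_substitution_general[of "{}" _ _ _ "-1" 1])
       (use assms in \<open>auto intro!: continuous_intros derivative_eq_intros\<close>)
  from integral_unique[OF this]
  have "integral {0..pi} (\<lambda>t. - sin t *\<^sub>R ?f (cos t)) = - integral {-1..1} ?f"
    by simp
  moreover have "integral {0..pi} (\<lambda>t. - sin t *\<^sub>R ?f (cos t)) = integral {0..pi} (\<lambda>t. - (p (cos t) * (sin t)\<^sup>2))"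
  proof (rule integral_cong)
    fix t :: real assume "t \<in> {0..pi}"
    hence "sqrt (1 - (cos t)\<^sup>2) = sin t"
      using sin_ge_zero[of t] by (simp flip: sin_squared_eq)
    thus "- sin t *\<^sub>R ?f (cos t) = - (p (cos t) * (sin t)\<^sup>2)"
      by (simp add: power2_eq_square)
  qed
  ultimately show ?thesis by simp
qed

context qbase
begin

abbreviation rqfac :: "nat \<Rightarrow> real" where
  "rqfac n \<equiv> qpoch q q n"

lemma rqfac_Suc: "rqfac (Suc n) = rqfac n * (1 - q ^ Suc n)"
  by (simp add: qpoch_Suc)

lemma rqfac_nonzero [simp]: "rqfac n \<noteq> 0"
  using qfac_nonzero[of n] of_real_qpoch[where ?'a = complex, of q q n] by (metis of_real_0)

lemma one_minus_qpow [simp]: "n > 0 \<Longrightarrow> 1 - q ^ n \<noteq> 0"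
  using power_neq_1[of n] by (metis eq_iff_diff_eq_0 of_real_1 of_real_power)

lemma one_plus_qpow [simp]: "1 + q ^ n \<noteq> 0"
proof (cases "n = 0")
  case False
  hence "1 - q ^ (2 * n) \<noteq> 0" by (intro one_minus_qpow) auto
  moreover have "1 - q ^ (2 * n) = (1 + q ^ n) * (1 - q ^ n)"
    by (simp add: mult_2_right power_add algebra_simps)
  ultimately show ?thesis by auto
qed simp

text \<open>
  The product starts at \<open>k = 0\<close>, one factor earlier than in \<^const>\<open>qhermite_density\<close>. Because
  \<open>l(cos t|1) = 4 sin\<^sup>2 t\<close>, the additional factor supplies both \<open>sqrt (1 - x\<^sup>2)\<close> and the Jacobian of
  \<open>x = cos t\<close>, and the induction on \<open>N\<close> can begin with Lebesgue measure on \<open>[0,\<pi>]\<close>.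
\<close>

definition trunc_moment :: "nat \<Rightarrow> nat \<Rightarrow> real" where
  "trunc_moment N n =
     integral {0..pi} (\<lambda>t. qhermite n (cos t) q * (\<Prod>k<N. qhermite_l (cos t) (q ^ k)))"

lemma trunc_moment_0:
  "trunc_moment 0 n = (if even n then pi * rqfac n / (rqfac (n div 2))\<^sup>2 else 0)"
proof -
  have int: "integral {0..pi} (\<lambda>t. cos ((real n - 2 * real k) * t)) = (if n = 2 * k then pi else 0)" for k
    using integral_cos_multiple[of "int n - 2 * int k"] by auto
  have "trunc_moment 0 n = integral {0..pi} (\<lambda>t. \<Sum>k\<le>n. qbinomial n k q * cos ((real n - 2 * real k) * t))"
    by (simp add: trunc_moment_def qhermite_cos_sum)
  also have "\<dots> = (\<Sum>k\<le>n. integral {0..pi} (\<lambda>t. qbinomial n k q * cos ((real n - 2 * real k) * t)))"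
    by (intro integral_sum integrable_continuous_real) (auto intro!: continuous_intros)
  also have "\<dots> = (\<Sum>k\<le>n. if n = 2 * k then pi * qbinomial n k q else 0)"
    by (intro sum.cong) (auto simp: int)
  also have "\<dots> = (if even n then pi * rqfac n / (rqfac (n div 2))\<^sup>2 else 0)"
  proof (cases "even n")
    case True
    then obtain m where m: "n = 2 * m" by blast
    have "(\<Sum>k\<le>n. if n = 2 * k then pi * qbinomial n k q else 0) =
        (\<Sum>k\<le>n. if k = m then pi * qbinomial n m q else 0)"
      by (rule sum.cong) (auto simp: m)
    thus ?thesis by (simp add: m qbinomial_def power2_eq_square)
  next
    case False
    thus ?thesis by (auto intro!: sum.neutral)
  qed
  finally show ?thesis .
qed

lemma four_x2_qhermite:
  "4 * x\<^sup>2 * qhermite n x q = qhermite (n + 2) x q + (2 - q ^ Suc n - q ^ n) * qhermite n x q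
     + (1 - q ^ n) * (1 - q ^ (n - 1)) * qhermite (n - 2) x q"
proof -
  have "4 * x\<^sup>2 * qhermite n x q = 2 * x * qhermite (Suc n) x q +
     (1 - q ^ n) * (2 * x * qhermite (n - 1) x q)"
    using arg_cong[OF qhermite_times_x[of x n], of "\<lambda>y. 2 * x * y"]
    by (simp add: power2_eq_square algebra_simps)
  also have "(1 - q ^ n) * (2 * x * qhermite (n - 1) x q) =
      (1 - q ^ n) * (qhermite n x q + (1 - q ^ (n - 1)) * qhermite (n - 2) x q)"
    using qhermite_times_x[of x "n - 1"] by (cases n) (simp_all add: numeral_2_eq_2)
  finally show ?thesis
    using qhermite_times_x[of x "Suc n"] by (simp add: algebra_simps)
qed

text \<open>
  The new factor is \<open>l(x|q\<^sup>N) = (1 + q\<^sup>N)\<^sup>2 - 4 q\<^sup>N x\<^sup>2\<close>, and multiplication by \<open>4 x\<^sup>2\<close> is two steps of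
  the three-term recurrence.
\<close>

lemma trunc_moment_Suc:
  "trunc_moment (Suc N) n = ((1 + q ^ N)\<^sup>2 - q ^ N * (2 - q ^ Suc n - q ^ n)) * trunc_moment N n
     - q ^ N * trunc_moment N (n + 2)
     - q ^ N * (1 - q ^ n) * (1 - q ^ (n - 1)) * trunc_moment N (n - 2)"
proof -
  let ?w = "\<lambda>t. \<Prod>k<N. qhermite_l (cos t) (q ^ k)"
  have I: "(\<lambda>t. c * (qhermite m (cos t) q * ?w t)) integrable_on {0..pi}" for c m
    unfolding qhermite_l_def
    by (intro integrable_continuous_real continuous_intros continuous_on_compose2[OF continuous_on_qhermite[of UNIV]]) auto
  have "trunc_moment (Suc N) n = integral {0..pi} (\<lambda>t.
      ((1 + q ^ N)\<^sup>2 - q ^ N * (2 - q ^ Suc n - q ^ n)) * (qhermite n (cos t) q * ?w t)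
     - q ^ N * (qhermite (n + 2) (cos t) q * ?w t)
     - q ^ N * (1 - q ^ n) * (1 - q ^ (n - 1)) * (qhermite (n - 2) (cos t) q * ?w t))"
    unfolding trunc_moment_def
  proof (rule integral_cong)
    fix t :: real
    have "qhermite n (cos t) q * (\<Prod>k<Suc N. qhermite_l (cos t) (q ^ k)) =
       ((1 + q ^ N)\<^sup>2 * qhermite n (cos t) q - q ^ N * (4 * (cos t)\<^sup>2 * qhermite n (cos t) q)) * ?w t"
      by (simp add: qhermite_l_def algebra_simps)
    also have "\<dots> = ((1 + q ^ N)\<^sup>2 - q ^ N * (2 - q ^ Suc n - q ^ n)) * (qhermite n (cos t) q * ?w t)
     - q ^ N * (qhermite (n + 2) (cos t) q * ?w t)
     - q ^ N * (1 - q ^ n) * (1 - q ^ (n - 1)) * (qhermite (n - 2) (cos t) q * ?w t)"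
      unfolding four_x2_qhermite by (simp only: algebra_simps)
    finally show "qhermite n (cos t) q * (\<Prod>k<Suc N. qhermite_l (cos t) (q ^ k)) = \<dots>" .
  qed
  also have "\<dots> = ((1 + q ^ N)\<^sup>2 - q ^ N * (2 - q ^ Suc n - q ^ n)) * trunc_moment N n
     - q ^ N * trunc_moment N (n + 2)
     - q ^ N * (1 - q ^ n) * (1 - q ^ (n - 1)) * trunc_moment N (n - 2)"
    unfolding trunc_moment_def
    by (subst integral_diff integral_mult_right | intro integrable_diff I)+ simp
  finally show ?thesis .
qed

lemma trunc_moment_odd: "odd n \<Longrightarrow> trunc_moment N n = 0"
proof (induction N arbitrary: n)
  case (Suc N)
  have "trunc_moment N (n - 2) = 0 \<or> 1 - q ^ (n - 1) = 0"
  proof (cases "n = 1")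
    case False
    hence "odd (n - 2)" using Suc.prems by presburger
    thus ?thesis using Suc.IH by blast
  qed auto
  with Suc show ?case by (auto simp: trunc_moment_Suc)
qed (simp add: trunc_moment_0)

text \<open>
  Equal to \<open>\<Prod>\<^sub>k\<^sub><\<^sub>N (1 + q\<^sup>k) (1 - q\<^sup>2\<^sup>k\<^sup>+\<^sup>1)\<close>, in the form that shows the limit for \<open>N \<rightarrow> \<infinity>\<close>.
\<close>

definition trunc_mass :: "nat \<Rightarrow> real" where
  "trunc_mass N = 2 * rqfac (2 * N) / (rqfac N * (1 + q ^ N))"

lemma trunc_mass_Suc: "trunc_mass (Suc N) = trunc_mass N * (1 + q ^ N) * (1 - q ^ Suc (2 * N))"
proof -
  have eq: "rqfac (2 * Suc N) = rqfac (2 * N) * (1 - q ^ Suc (2 * N)) * (1 - q ^ Suc N) * (1 + q ^ Suc N)"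
  proof -
    have "(1 - q ^ Suc N) * (1 + q ^ Suc N) = 1 - q ^ Suc (Suc (2 * N))"
      by (simp add: mult_2_right power_add algebra_simps)
    thus ?thesis by (simp add: rqfac_Suc mult.assoc del: power_Suc)
  qed
  show ?thesis
    unfolding trunc_mass_def eq rqfac_Suc[of N]
    using one_minus_qpow[of "Suc N"] one_plus_qpow[of N] one_plus_qpow[of "Suc N"]
    by (simp del: power_Suc one_minus_qpow one_plus_qpow)
qed

text \<open>
  The truncated weight belongs, up to normalisation, to the continuous \<open>q\<close>-ultraspherical
  polynomials with \<open>\<beta> = q\<^sup>N\<close>, and up to the total mass the formula is the constant term in Rogers'
  connection formula from parameter \<open>0\<close> to \<open>\<beta>\<close>. Once it is known, \<open>trunc_moment_Suc\<close> reduces the induction to one rational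
  identity in \<open>q\<close>, \<open>q\<^sup>n\<close> and \<open>q\<^sup>N\<close>.
\<close>

lemma trunc_moment_even:
  "trunc_moment N (2 * n) = pi * trunc_mass N * q ^ (N * n) * rqfac (2 * n) / (rqfac n * rqfac (N + n))"
proof (induction N arbitrary: n)
  case 0
  show ?case by (simp add: trunc_moment_0 trunc_mass_def power2_eq_square)
next
  case (Suc N)
  note IH = Suc.IH
  define y where "y = q ^ n"
  define z where "z = q ^ N"
  define T where "T = pi * trunc_mass N * q ^ (N * n) * rqfac (2 * n) / (rqfac n * rqfac (N + n))"
  have T: "trunc_moment N (2 * n) = T" unfolding T_def by (rule IH)
  have nz: "1 - q * y \<noteq> 0" "1 - z * q * y \<noteq> 0"
    using one_minus_qpow[of "Suc n"] one_minus_qpow[of "Suc (N + n)"]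
    by (simp_all add: y_def z_def power_add mult_ac del: one_minus_qpow)
  have y2: "q ^ (2 * n) = y\<^sup>2" "q ^ (2 * N) = z\<^sup>2"
    by (simp_all add: y_def z_def power_mult[symmetric] mult.commute)
  \<comment> \<open>Both neighbouring moments are rational multiples of \<open>T\<close>. The second one is taken together with
    its prefactor, so that no division by \<open>z\<close> occurs when \<open>q = 0\<close>.\<close>
  have up: "trunc_moment N (2 * n + 2) = T * (z * (1 - q * y\<^sup>2) * (1 + q * y) / (1 - z * q * y))"
  proof -
    have "rqfac (2 * Suc n) = rqfac (2 * n) * (1 - q * q ^ (2 * n)) * (1 - q * (q * q ^ (2 * n)))"
      by (simp add: rqfac_Suc)
    hence "rqfac (2 * Suc n) = rqfac (2 * n) * (1 - q * y\<^sup>2) * ((1 - q * y) * (1 + q * y))"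
      unfolding y2 by (simp add: algebra_simps power2_eq_square)
    moreover have "rqfac (Suc n) = rqfac n * (1 - q * y)" "rqfac (N + Suc n) = rqfac (N + n) * (1 - z * q * y)"
      by (simp_all add: rqfac_Suc y_def z_def power_add mult_ac)
    moreover have "q ^ (N * Suc n) = q ^ (N * n) * z"
      by (simp add: z_def power_add mult_ac)
    ultimately show ?thesis
      using IH[of "Suc n"] nz by (simp add: T_def mult_ac)
  qed
  have down: "z * (1 - q ^ (2 * n)) * (1 - q ^ (2 * n - 1)) * trunc_moment N (2 * n - 2) =
     T * ((1 - y) * (1 - z * y))"
  proof (cases n)
    case 0
    thus ?thesis by (simp add: y_def)
  next
    case (Suc m)
    have "rqfac (2 * n) = rqfac (2 * m) * (1 - q ^ (2 * n - 1)) * (1 - q ^ (2 * n))"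
      by (simp add: rqfac_Suc Suc)
    moreover have "rqfac n = rqfac m * (1 - y)" "rqfac (N + n) = rqfac (N + m) * (1 - z * y)"
      by (simp_all add: rqfac_Suc y_def z_def power_add Suc mult_ac)
    moreover have "q ^ (N * n) = q ^ (N * m) * z"
      by (simp add: z_def power_add Suc mult_ac)
    moreover have "1 - y \<noteq> 0" "1 - z * y \<noteq> 0"
      using one_minus_qpow[of n] one_minus_qpow[of "N + n"] Suc
      by (simp_all add: y_def z_def power_add mult_ac del: one_minus_qpow)
    ultimately show ?thesis
      using IH[of m] by (simp add: T_def) (simp add: Suc)
  qed
  have "trunc_moment (Suc N) (2 * n) = T * ((1 + z)\<^sup>2 - z * (2 - q * y\<^sup>2 - y\<^sup>2)
      - z * (z * (1 - q * y\<^sup>2) * (1 + q * y) / (1 - z * q * y)) - (1 - y) * (1 - z * y))"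
    unfolding trunc_moment_Suc up z_def[symmetric] down T
    by (simp only: y2 power_Suc) (simp add: algebra_simps)
  also have "(1 + z)\<^sup>2 - z * (2 - q * y\<^sup>2 - y\<^sup>2)
      - z * (z * (1 - q * y\<^sup>2) * (1 + q * y) / (1 - z * q * y)) - (1 - y) * (1 - z * y)
     = y * (1 + z) * (1 - q * z\<^sup>2) / (1 - z * q * y)"
    using nz by (simp add: divide_simps) (simp add: algebra_simps power2_eq_square)
  also have "T * \<dots> = pi * trunc_mass (Suc N) * q ^ (Suc N * n) * rqfac (2 * n) / (rqfac n * rqfac (Suc N + n))"
  proof -
    have "rqfac (Suc N + n) = rqfac (N + n) * (1 - z * q * y)"
      by (simp add: rqfac_Suc y_def z_def power_add mult_ac)
    moreover have "q ^ (Suc N * n) = q ^ (N * n) * y"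
      by (simp add: y_def power_add mult_ac)
    ultimately show ?thesis
      using nz by (simp add: T_def trunc_mass_Suc y2 mult.assoc mult.left_commute flip: z_def)
  qed
  finally show ?case .
qed

lemma rqfac_LIMSEQ: "rqfac \<longlonglongrightarrow> qpoch_inf q q"
  using qpoch_LIMSEQ[OF abs_q, of q] by simp

lemma rqfac_inf_nonzero: "qpoch_inf q q \<noteq> 0"
  using qpoch_inf_nonzero[OF abs_q, of qc] of_real_qpoch_inf[OF abs_q, of q] abs_q
  by (metis norm_of_real of_real_0)

lemma trunc_mass_LIMSEQ: "trunc_mass \<longlonglongrightarrow> 2"
proof -
  have "(\<lambda>N. rqfac (2 * N)) \<longlonglongrightarrow> qpoch_inf q q"
    using LIMSEQ_subseq_LIMSEQ[OF rqfac_LIMSEQ, of "\<lambda>N. 2 * N"]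
    by (simp add: o_def strict_mono_def)
  moreover have "(\<lambda>N. q ^ N) \<longlonglongrightarrow> 0"
    using abs_q by (intro LIMSEQ_power_zero) auto
  ultimately have "trunc_mass \<longlonglongrightarrow> 2 * qpoch_inf q q / (qpoch_inf q q * (1 + 0))"
    unfolding trunc_mass_def[abs_def] using rqfac_inf_nonzero rqfac_LIMSEQ
    by (intro tendsto_divide tendsto_mult tendsto_add tendsto_const) auto
  thus ?thesis using rqfac_inf_nonzero by simp
qed

text \<open>
  For \<open>n > 0\<close> the factor \<open>q\<^sup>N\<^sup>n\<close> in the closed form tends to 0 and the others stay bounded.
\<close>

lemma trunc_moment_LIMSEQ:
  "(\<lambda>N. trunc_moment N n) \<longlonglongrightarrow> (if n = 0 then 2 * pi / qpoch_inf q q else 0)"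
proof (cases "even n")
  case False
  thus ?thesis by (auto simp: trunc_moment_odd)
next
  case True
  then obtain m where m: "n = 2 * m" by blast
  have "(\<lambda>N. (q ^ m) ^ N) \<longlonglongrightarrow> (if m = 0 then 1 else 0)"
    using abs_q by (auto simp: power_abs power_less_one_iff intro!: LIMSEQ_power_zero)
  hence q: "(\<lambda>N. q ^ (N * m)) \<longlonglongrightarrow> (if m = 0 then 1 else 0)"
    by (simp add: power_mult[symmetric] mult.commute)
  have "(\<lambda>N. rqfac (N + m)) \<longlonglongrightarrow> qpoch_inf q q"
    by (rule LIMSEQ_ignore_initial_segment[OF rqfac_LIMSEQ])
  hence "(\<lambda>N. trunc_moment N n) \<longlonglongrightarrow>
      pi * 2 * (if m = 0 then 1 else 0) * rqfac (2 * m) / (rqfac m * qpoch_inf q q)"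
    unfolding m trunc_moment_even using rqfac_inf_nonzero
    by (intro tendsto_intros q trunc_mass_LIMSEQ) auto
  thus ?thesis by (auto simp: m mult.commute split: if_splits)
qed

text \<open>
  Integration and the limit \<open>N \<rightarrow> \<infinity>\<close> commute because the products converge uniformly.
\<close>

lemma qhermite_density_moment:
  "integral {-1..1} (\<lambda>x. qhermite n x q * qhermite_density x q) = (if n = 0 then 1 else 0)"
proof -
  let ?w = "\<lambda>N x. \<Prod>k<N. qhermite_l x (q ^ Suc k)"
  let ?v = "\<lambda>x. \<Prod>k. qhermite_l x (q ^ Suc k)"
  have bd: "bounded (f ` {-1..1})" if "continuous_on {-1..1} f" for f :: "real \<Rightarrow> real"
    using that by (intro compact_imp_bounded compact_continuous_image) auto
  have "continuous_on {-1..1} ?v"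
    by (rule uniform_limit_theorem[OF _ uniform_limit_qhermite_l_prod[OF abs_q]])
       (auto simp: qhermite_l_def intro!: always_eventually continuous_intros)
  hence "uniform_limit {-1..1} (\<lambda>N x. qhermite n x q * sqrt (1 - x\<^sup>2) * ?w N x)
      (\<lambda>x. qhermite n x q * sqrt (1 - x\<^sup>2) * ?v x) sequentially"
    by (intro uniform_lim_mult uniform_limit_qhermite_l_prod abs_q bd uniform_limit_const continuous_intros)
  then obtain I L where I: "\<And>N. ((\<lambda>x. qhermite n x q * sqrt (1 - x\<^sup>2) * ?w N x) has_integral I N) {-1..1}"
    and L: "((\<lambda>x. qhermite n x q * sqrt (1 - x\<^sup>2) * ?v x) has_integral L) {-1..1}" and lim: "I \<longlonglongrightarrow> L"
    by (rule uniform_limit_integral) (auto simp: qhermite_l_def intro!: continuous_intros)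
  have IN: "I N = trunc_moment (Suc N) n / 4" for N
  proof -
    have "I N = integral {-1..1} (\<lambda>x. (qhermite n x q * ?w N x) * sqrt (1 - x\<^sup>2))"
      using integral_unique[OF I[of N]] by (simp add: mult_ac)
    also have "\<dots> = integral {0..pi} (\<lambda>t. (qhermite n (cos t) q * ?w N (cos t)) * (sin t)\<^sup>2)"
      by (rule integral_sqrt_substitution) (auto simp: qhermite_l_def intro!: continuous_intros)
    also have "\<dots> = integral {0..pi} (\<lambda>t. qhermite n (cos t) q * (\<Prod>k<Suc N. qhermite_l (cos t) (q ^ k)) / 4)"
    proof (rule integral_cong)
      fix t :: real
      have "qhermite_l (cos t) 1 = 4 * (sin t)\<^sup>2"
        by (simp add: qhermite_l_def sin_squared_eq)
      thus "(qhermite n (cos t) q * ?w N (cos t)) * (sin t)\<^sup>2 =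
          qhermite n (cos t) q * (\<Prod>k<Suc N. qhermite_l (cos t) (q ^ k)) / 4"
        unfolding prod.lessThan_Suc_shift by simp
    qed
    finally show ?thesis by (simp add: trunc_moment_def del: prod.lessThan_Suc)
  qed
  have "I \<longlonglongrightarrow> (if n = 0 then 2 * pi / qpoch_inf q q else 0) / 4"
    unfolding IN[abs_def] by (intro tendsto_divide LIMSEQ_Suc[OF trunc_moment_LIMSEQ]) auto
  hence L': "L = (if n = 0 then 2 * pi / qpoch_inf q q else 0) / 4"
    using lim LIMSEQ_unique by blast
  have "integral {-1..1} (\<lambda>x. qhermite n x q * qhermite_density x q) =
     integral {-1..1} (\<lambda>x. 2 * qpoch_inf q q / pi * (qhermite n x q * sqrt (1 - x\<^sup>2) * ?v x))"
    by (simp add: qhermite_density_def mult_ac)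
  also have "\<dots> = 2 * qpoch_inf q q / pi * L"
    unfolding integral_mult_right using integral_unique[OF L] by simp
  finally show ?thesis
    using rqfac_inf_nonzero by (simp add: L')
qed

lemma AW_integral_base: "AW_integral n 0 0 0 0 = (if n = 0 then 1 else 0)"
proof -
  have "(\<lambda>x. qhermite n x q * qhermite_density x q) integrable_on {-1..1}"
    by (intro integrable_continuous_real continuous_intros continuous_on_qhermite_density abs_q)
  from has_integral_of_real[OF integrable_integral[OF this]]
  have "((\<lambda>x. complex_of_real (qhermite n x q * qhermite_density x q)) has_integral
     of_real (if n = 0 then 1 else 0)) {-1..1}"
    unfolding qhermite_density_moment by simp
  thus ?thesis
    by (simp add: AW_integral_def integral_unique)
qed

lemma AW_moment:
  assumes "norm a < 1" "norm b < 1" "norm c < 1" "norm d < 1"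
  shows "((\<lambda>x::real. of_real (qhermite n x q) * AW_density x a b c d q)
           has_integral sigma4 n a b c d q) {-1..1}"
proof -
  let ?g = "\<lambda>x. qhermite_gf x a q * (complex_of_real (qhermite n x q) *
     of_real (qhermite_density x q) * qhermite_gf x b q * qhermite_gf x c q * qhermite_gf x d q)"
  have "?g integrable_on {-1..1}"
    by (intro integrable_continuous_real continuous_on_mult[OF continuous_on_qhermite_gf
        continuous_on_AW_integral_kernel] assms)
  hence "(?g has_integral AW_mass a b c d * sigma4 n a b c d q) {-1..1}"
    unfolding AW_integral_eval[OF AW_integral_base assms, symmetric] AW_integral_def by (rule integrable_integral)
  from has_integral_mult_right[OF this, of "inverse (AW_mass a b c d)"]
  have "((\<lambda>x. inverse (AW_mass a b c d) * ?g x) has_integral sigma4 n a b c d q) {-1..1}"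
    unfolding mult.assoc[symmetric, of "inverse (AW_mass a b c d)" "AW_mass a b c d"]
    using AW_mass_nonzero[OF assms] by simp
  moreover have "of_real (qhermite n x q) * AW_density x a b c d q = inverse (AW_mass a b c d) * ?g x" for x
    by (simp add: AW_density_def AW_mass_def mult_ac)
  ultimately show ?thesis by (simp only:)
qed

end

theorem corollary3:
  fixes q :: real and a b c d :: complex and n :: nat
  assumes "-1 < q" and "q < 1"
    and "Max {cmod a, cmod b, cmod c, cmod d} < 1"
  shows "((\<lambda>x::real. of_real (qhermite n x q) * AW_density x a b c d q)
           has_integral sigma4 n a b c d q) {-1..1}"
proof -
  interpret qbase q
    using assms by unfold_locales auto
  show ?thesis
    using assms(3) by (intro AW_moment) auto
qed

end
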